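(* Let $r,c,t$ be positive integers. The homology of the complex $(\mathcal{C}(r,c,t),d)$ is concentrated in even ranks, and the homology classes of the basis elements $T\in SSYT(r,c,t)$ that are unmatched by $M$ form an $\mathbb{F}_2$-basis of $H_*(\mathcal{C}(r,c,t),d)$.
   Context: $SSYT(r,c,t)$ is the set of $r\times c$ arrays $T=(T_{R,j})$ (rows $1,\dots,r$ top to bottom) with entries in $\{0,\dots,r+t-1\}$, weakly increasing along rows and strictly increasing down columns, ranked by $\mathrm{rank}(T)=\|T\|-c\binom{r}{2}$ ($\|T\|$ = sum of entries). $\mathcal{C}(r,c,t)$ is the $\mathbb{F}_2$-space with basis $SSYT(r,c,t)$, graded by rank. An occurrence of a value $v$ in row $R$, column $j$, is free if $R=1$ or $T_{R-1,j}\ne v-1$. The boundary $d(T)$ is the sum, over all pairs $(R,v)$ with $v$ odd occurring in row $R$ with an odd number of free occurrences, of the tableau obtained by replacing the leftmost $v$ in row $R$ by $v-1$; $d^2=0$. The matching $M$: $(R,i)$ satisfies (1) if $i$ is odd, occurs in row $R$, and has an odd number of free occurrences in row $R$; $(R,i)$ satisfies (2) if $i$ is even, $i<r+t-1$, $i$ occurs in row $R$, the rightmost $i$ in row $R$ does not have $i+1$ immediately below (vacuous if $R=r$), and the number of free occurrences of $i+1$ in row $R$ is even (possibly zero). $T$ is unmatched if no $(R,i)$ satisfies (1) or (2); otherwise, with $R$ the smallest such row and $i$ the smallest such value in it, $M(T)$ decrements the leftmost $i$ in row $R$ if $i$ is odd and increments the rightmost $i$ in row $R$ if $i$ is even. 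*)

theory Defs
  imports "Jordan_Normal_Form.VS_Connect" "HOL-Library.Z2" "HOL-Algebra.AbelCoset"
begin

text \<open>
  An \<open>r \<times> c\<close> array is a function of (row, column), rows and columns numbered from 1,
  extensional outside \<open>{1..r} \<times> {1..c}\<close>.
\<close>

type_synonym tableau = "nat \<times> nat \<Rightarrow> nat"

definition SSYT :: "nat \<Rightarrow> nat \<Rightarrow> nat \<Rightarrow> tableau set" where
  "SSYT r c t = {T \<in> ({1..r} \<times> {1..c}) \<rightarrow>\<^sub>E {0..r + t - 1}.
     (\<forall>R\<in>{1..r}. \<forall>j\<in>{1..c}. \<forall>j'\<in>{1..c}. j \<le> j' \<longrightarrow> T (R, j) \<le> T (R, j')) \<and>
     (\<forall>j\<in>{1..c}. \<forall>R\<in>{1..r}. \<forall>R'\<in>{1..r}. R < R' \<longrightarrow> T (R, j) < T (R', j))}"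

definition tab_rank :: "nat \<Rightarrow> nat \<Rightarrow> tableau \<Rightarrow> int" where
  "tab_rank r c T = int (\<Sum>x\<in>{1..r} \<times> {1..c}. T x) - int (c * (r choose 2))"

definition occurrences :: "nat \<Rightarrow> tableau \<Rightarrow> nat \<Rightarrow> nat \<Rightarrow> nat set" where
  "occurrences c T R v = {j \<in> {1..c}. T (R, j) = v}"

definition free_occurrences :: "nat \<Rightarrow> tableau \<Rightarrow> nat \<Rightarrow> nat \<Rightarrow> nat set" where
  "free_occurrences c T R v =
     {j \<in> occurrences c T R v. R = 1 \<or> T (R - 1, j) + 1 \<noteq> v}"

definition decrement :: "nat \<Rightarrow> tableau \<Rightarrow> nat \<Rightarrow> nat \<Rightarrow> tableau" where
  "decrement c T R v = T((R, Min (occurrences c T R v)) := v - 1)"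

definition increment :: "nat \<Rightarrow> tableau \<Rightarrow> nat \<Rightarrow> nat \<Rightarrow> tableau" where
  "increment c T R v = T((R, Max (occurrences c T R v)) := v + 1)"

definition cond1 :: "nat \<Rightarrow> nat \<Rightarrow> tableau \<Rightarrow> nat \<Rightarrow> nat \<Rightarrow> bool" where
  "cond1 r c T R i \<longleftrightarrow> R \<in> {1..r} \<and> odd i \<and> occurrences c T R i \<noteq> {} \<and>
     odd (card (free_occurrences c T R i))"

definition cond2 :: "nat \<Rightarrow> nat \<Rightarrow> nat \<Rightarrow> tableau \<Rightarrow> nat \<Rightarrow> nat \<Rightarrow> bool" where
  "cond2 r c t T R i \<longleftrightarrow> R \<in> {1..r} \<and> even i \<and> i < r + t - 1 \<and> occurrences c T R i \<noteq> {} \<and>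
     (R = r \<or> T (R + 1, Max (occurrences c T R i)) \<noteq> i + 1) \<and>
     even (card (free_occurrences c T R (i + 1)))"

definition matching :: "nat \<Rightarrow> nat \<Rightarrow> nat \<Rightarrow> tableau \<Rightarrow> tableau option" where
  "matching r c t T =
     (if \<exists>R i. cond1 r c T R i \<or> cond2 r c t T R i then
        let R = (LEAST R. \<exists>i. cond1 r c T R i \<or> cond2 r c t T R i);
            i = (LEAST i. cond1 r c T R i \<or> cond2 r c t T R i)
        in Some (if odd i then decrement c T R i else increment c T R i)
      else None)"

definition unmatched :: "nat \<Rightarrow> nat \<Rightarrow> nat \<Rightarrow> tableau set" where
  "unmatched r c t = {T \<in> SSYT r c t. matching r c t T = None}"

lemma unmatched_iff:
  "T \<in> unmatched r c t \<longleftrightarrow>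
     T \<in> SSYT r c t \<and> (\<nexists>R i. cond1 r c T R i \<or> cond2 r c t T R i)"
  by (auto simp: unmatched_def matching_def Let_def)

type_synonym chain = "tableau \<Rightarrow> bit"

definition F2 :: "bit ring" where
  "F2 = class_ring"

text \<open>\<open>SSYT r c t\<close> is finite, so all functions on it to \<open>F2\<close> form the space with that basis.\<close>

definition chain_space :: "nat \<Rightarrow> nat \<Rightarrow> nat \<Rightarrow> (bit, chain) module" where
  "chain_space r c t = ring.func_space F2 (SSYT r c t)"

definition basis_elt :: "nat \<Rightarrow> nat \<Rightarrow> nat \<Rightarrow> tableau \<Rightarrow> chain" where
  "basis_elt r c t T = (\<lambda>U\<in>SSYT r c t. if U = T then 1 else 0)"

definition graded_part :: "nat \<Rightarrow> nat \<Rightarrow> nat \<Rightarrow> int \<Rightarrow> chain set" where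
  "graded_part r c t k =
     {x \<in> carrier (chain_space r c t). \<forall>T\<in>SSYT r c t. x T \<noteq> 0 \<longrightarrow> tab_rank r c T = k}"

text \<open>
  The summands of the boundary of a tableau are indexed by exactly the pairs satisfying the first
  matching condition. A summand outside \<open>SSYT\<close> would be read as 0; \<open>decrement_SSYT\<close> shows that
  there is none.
\<close>

definition tab_boundary :: "nat \<Rightarrow> nat \<Rightarrow> nat \<Rightarrow> tableau \<Rightarrow> chain" where
  "tab_boundary r c t T =
     (\<Oplus>\<^bsub>chain_space r c t\<^esub>p\<in>{(R, v). cond1 r c T R v}. basis_elt r c t (decrement c T (fst p) (snd p)))"

definition boundary :: "nat \<Rightarrow> nat \<Rightarrow> nat \<Rightarrow> chain \<Rightarrow> chain" where
  "boundary r c t x =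
     (\<Oplus>\<^bsub>chain_space r c t\<^esub>T\<in>SSYT r c t. x T \<odot>\<^bsub>chain_space r c t\<^esub> tab_boundary r c t T)"

definition cycles :: "nat \<Rightarrow> nat \<Rightarrow> nat \<Rightarrow> chain set" where
  "cycles r c t = {x \<in> carrier (chain_space r c t). boundary r c t x = \<zero>\<^bsub>chain_space r c t\<^esub>}"

definition boundaries :: "nat \<Rightarrow> nat \<Rightarrow> nat \<Rightarrow> chain set" where
  "boundaries r c t = boundary r c t ` carrier (chain_space r c t)"

definition quotient_module :: "('a, 'b) module \<Rightarrow> 'b set \<Rightarrow> ('a, 'b set) module" where
  "quotient_module V W =
     \<lparr>carrier = a_rcosets\<^bsub>V\<^esub> W, mult = undefined, one = undefined, zero = W, add = set_add V,
      smult = (\<lambda>a X. \<Union>x\<in>X. W +>\<^bsub>V\<^esub> (a \<odot>\<^bsub>V\<^esub> x))\<rparr>"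

definition homology :: "nat \<Rightarrow> nat \<Rightarrow> nat \<Rightarrow> (bit, chain set) module" where
  "homology r c t =
     quotient_module (chain_space r c t\<lparr>carrier := cycles r c t\<rparr>) (boundaries r c t)"

definition homology_at :: "nat \<Rightarrow> nat \<Rightarrow> nat \<Rightarrow> int \<Rightarrow> (bit, chain set) module" where
  "homology_at r c t k =
     quotient_module (chain_space r c t\<lparr>carrier := cycles r c t \<inter> graded_part r c t k\<rparr>)
       (boundary r c t ` graded_part r c t (k + 1))"

definition homology_class :: "nat \<Rightarrow> nat \<Rightarrow> nat \<Rightarrow> chain \<Rightarrow> chain set" where
  "homology_class r c t z = boundaries r c t +>\<^bsub>chain_space r c t\<^esub> z"

declare add_bit_eq_xor [simp del] mult_bit_eq_and [simp del] sum_of_bool_eq [simp del]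
  sum_mult_of_bool_eq [simp del] sum_of_bool_mult_eq [simp del]

lemma field_F2: "field F2"
  unfolding F2_def by (rule class_field)

lemma F2_simps [simp]:
  "carrier F2 = UNIV" "mult F2 = (*)" "one F2 = 1" "zero F2 = 0" "add F2 = (+)"
  by (simp_all add: F2_def)

lemma chain_space_simps:
  "carrier (chain_space r c t) = SSYT r c t \<rightarrow>\<^sub>E UNIV"
  "zero (chain_space r c t) = (\<lambda>T\<in>SSYT r c t. 0)"
  "add (chain_space r c t) = (\<lambda>x y. \<lambda>T\<in>SSYT r c t. x T + y T)"
  "smult (chain_space r c t) = (\<lambda>a x. \<lambda>T\<in>SSYT r c t. a * x T)"
proof -
  interpret field F2 by (rule field_F2)
  show "carrier (chain_space r c t) = SSYT r c t \<rightarrow>\<^sub>E UNIV"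
    "zero (chain_space r c t) = (\<lambda>T\<in>SSYT r c t. 0)"
    "add (chain_space r c t) = (\<lambda>x y. \<lambda>T\<in>SSYT r c t. x T + y T)"
    "smult (chain_space r c t) = (\<lambda>a x. \<lambda>T\<in>SSYT r c t. a * x T)"
    by (simp_all add: chain_space_def func_space_def)
qed

lemma vectorspace_chain_space: "vectorspace F2 (chain_space r c t)"
proof -
  interpret field F2 by (rule field_F2)
  show ?thesis
    unfolding chain_space_def vectorspace_def
    using func_space_is_module field_F2 by blast
qed

lemma SSYT_PiE: "T \<in> SSYT r c t \<Longrightarrow> T \<in> ({1..r} \<times> {1..c}) \<rightarrow>\<^sub>E {0..r + t - 1}"
  by (simp only: SSYT_def mem_Collect_eq)

lemma SSYT_row:
  "T \<in> SSYT r c t \<Longrightarrow> R \<in> {1..r} \<Longrightarrow> j \<in> {1..c} \<Longrightarrow> j' \<in> {1..c} \<Longrightarrow> j \<le> j' \<Longrightarrow>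
    T (R, j) \<le> T (R, j')"
  by (simp only: SSYT_def mem_Collect_eq)

lemma SSYT_col:
  "T \<in> SSYT r c t \<Longrightarrow> j \<in> {1..c} \<Longrightarrow> R \<in> {1..r} \<Longrightarrow> R' \<in> {1..r} \<Longrightarrow> R < R' \<Longrightarrow>
    T (R, j) < T (R', j)"
  by (simp only: SSYT_def mem_Collect_eq)

lemma finite_SSYT [simp]: "finite (SSYT r c t)"
proof (rule finite_subset)
  show "SSYT r c t \<subseteq> ({1..r} \<times> {1..c}) \<rightarrow>\<^sub>E {0..r + t - 1}"
    by (auto simp: SSYT_def)
qed (intro finite_PiE, auto)

lemma finsum_chain_apply:
  assumes "finite A" "\<And>a. a \<in> A \<Longrightarrow> f a \<in> carrier (chain_space r c t)" "U \<in> SSYT r c t"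
  shows "(\<Oplus>\<^bsub>chain_space r c t\<^esub>a\<in>A. f a) U = (\<Sum>a\<in>A. f a U)"
proof -
  interpret vectorspace F2 "chain_space r c t" by (rule vectorspace_chain_space)
  show ?thesis using assms(1,2)
  proof (induction A rule: finite_induct)
    case empty
    then show ?case using assms(3) by (simp add: chain_space_simps)
  next
    case (insert a A)
    have "(\<Oplus>\<^bsub>chain_space r c t\<^esub>b\<in>insert a A. f b) = f a \<oplus>\<^bsub>chain_space r c t\<^esub> (\<Oplus>\<^bsub>chain_space r c t\<^esub>b\<in>A. f b)"
      using insert by (intro M.finsum_insert) auto
    then show ?case using insert assms(3) by (simp add: chain_space_simps)
  qed
qed

lemma finite_cond1 [simp]: "finite {(R, v). cond1 r c T R v}"
proof (rule finite_subset)
  show "{(R, v). cond1 r c T R v} \<subseteq> {1..r} \<times> (T ` ({1..r} \<times> {1..c}))"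
    by (auto simp: cond1_def occurrences_def)
qed auto

lemma basis_elt_closed [simp]: "basis_elt r c t T \<in> carrier (chain_space r c t)"
  by (simp add: basis_elt_def chain_space_simps)

lemma tab_boundary_closed [simp]: "tab_boundary r c t T \<in> carrier (chain_space r c t)"
proof -
  interpret vectorspace F2 "chain_space r c t" by (rule vectorspace_chain_space)
  show ?thesis unfolding tab_boundary_def by (intro M.finsum_closed) auto
qed

lemma tab_boundary_apply:
  assumes "U \<in> SSYT r c t"
  shows "tab_boundary r c t T U =
    (\<Sum>p\<in>{(R, v). cond1 r c T R v}. of_bool (U = decrement c T (fst p) (snd p)))"
  unfolding tab_boundary_def
  using assms by (subst finsum_chain_apply) (auto simp: basis_elt_def[of _ _ _ "decrement _ _ _ _"]
    chain_space_simps intro!: sum.cong)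

lemma boundary_closed [simp]:
  "boundary r c t x \<in> carrier (chain_space r c t)"
proof -
  interpret vectorspace F2 "chain_space r c t" by (rule vectorspace_chain_space)
  show ?thesis unfolding boundary_def by (intro M.finsum_closed) auto
qed

lemma boundary_apply:
  assumes "U \<in> SSYT r c t"
  shows "boundary r c t x U = (\<Sum>T\<in>SSYT r c t. x T * tab_boundary r c t T U)"
proof -
  interpret vectorspace F2 "chain_space r c t" by (rule vectorspace_chain_space)
  show ?thesis
    unfolding boundary_def
    by (subst finsum_chain_apply) (use assms in \<open>auto simp: chain_space_simps intro!: sum.cong\<close>)
qed

text \<open>The leftmost occurrence of an odd value with an odd number of free occurrences is free.\<close>

lemma Min_occurrences_free:
  assumes T: "T \<in> SSYT r c t" and a: "cond1 r c T R v"
  defines "j \<equiv> Min (occurrences c T R v)"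
  shows "j \<in> free_occurrences c T R v"
proof -
  have R: "R \<in> {1..r}" and ne: "occurrences c T R v \<noteq> {}"
    and odd: "odd (card (free_occurrences c T R v))"
    using a by (auto simp: cond1_def)
  have fin: "finite (occurrences c T R v)" by (simp add: occurrences_def)
  have j: "j \<in> occurrences c T R v" unfolding j_def using fin ne by (rule Min_in)
  have "free_occurrences c T R v \<noteq> {}" using odd by (metis card.empty even_zero)
  then obtain j' where j': "j' \<in> free_occurrences c T R v" by blast
  then have j'o: "j' \<in> occurrences c T R v" by (simp add: free_occurrences_def)
  have le: "j \<le> j'" unfolding j_def using fin j'o by (rule Min_le)
  show ?thesis
  proof (cases "R = 1")
    case False
    then have R1: "R - 1 \<in> {1..r}" "R - 1 < R" using R by auto
    have jc: "j \<in> {1..c}" "j' \<in> {1..c}" "T (R, j') = v"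
      using j j'o by (auto simp: occurrences_def)
    have "T (R - 1, j) \<le> T (R - 1, j')"
      by (rule SSYT_row[OF T R1(1) jc(1,2) le])
    moreover have "T (R - 1, j') < T (R, j')"
      by (rule SSYT_col[OF T jc(2) R1(1) R R1(2)])
    moreover have "T (R - 1, j') + 1 \<noteq> v" using j' False by (auto simp: free_occurrences_def)
    ultimately show ?thesis using j jc by (auto simp: free_occurrences_def)
  qed (use j in \<open>simp add: free_occurrences_def\<close>)
qed

lemma decrement_SSYT:
  assumes T: "T \<in> SSYT r c t" and a: "cond1 r c T R v"
  shows "decrement c T R v \<in> SSYT r c t"
proof -
  define j where "j = Min (occurrences c T R v)"
  have R: "R \<in> {1..r}" and v: "odd v" using a by (auto simp: cond1_def)
  have fin: "finite (occurrences c T R v)" by (simp add: occurrences_def)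
  have j: "j \<in> {1..c}" "T (R, j) = v" and free: "R = 1 \<or> T (R - 1, j) + 1 \<noteq> v"
    using Min_occurrences_free[OF T a] by (auto simp: j_def free_occurrences_def occurrences_def)
  have v1: "v \<ge> 1" using v by (cases v) auto
  note PiE = SSYT_PiE[OF T] and row = SSYT_row[OF T] and col = SSYT_col[OF T]
  have D: "decrement c T R v = T((R, j) := v - 1)" by (simp add: decrement_def j_def)
  have left: "T (R, i) \<le> v - 1" if "i \<in> {1..c}" "i < j" for i
  proof -
    have "T (R, i) \<le> v" using row[OF R that(1) j(1)] that j by simp
    moreover have "T (R, i) \<noteq> v"
    proof
      assume "T (R, i) = v"
      then have "i \<in> occurrences c T R v" using that by (simp add: occurrences_def)
      then have "j \<le> i" unfolding j_def by (rule Min_le[OF fin])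
      then show False using that by simp
    qed
    ultimately show ?thesis by simp
  qed
  have up: "T (Q, j) < v - 1" if "Q \<in> {1..r}" "Q < R" for Q
  proof -
    have R1: "R - 1 \<in> {1..r}" "R - 1 < R" "R \<noteq> 1" using R that by auto
    have "T (R - 1, j) < v" using col[OF j(1) R1(1) R R1(2)] j by simp
    then have "T (R - 1, j) < v - 1" using free R1 by auto
    moreover have "T (Q, j) \<le> T (R - 1, j)"
      using col[OF j(1) that(1) R1(1)] that by (cases "Q = R - 1") (auto intro!: less_imp_le)
    ultimately show ?thesis by simp
  qed
  have vle: "v \<le> r + t - 1" using PiE R j by fastforce
  have "T((R, j) := v - 1) \<in> ({1..r} \<times> {1..c}) \<rightarrow>\<^sub>E {0..r + t - 1}"
    using PiE R j vle by (auto simp: PiE_iff extensional_def)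
  moreover have "(T((R, j) := v - 1)) (Q, i) \<le> (T((R, j) := v - 1)) (Q, i')"
    if "Q \<in> {1..r}" "i \<in> {1..c}" "i' \<in> {1..c}" "i \<le> i'" for Q i i'
    using row[OF that] left[of i] that j by (auto simp: le_less)
  moreover have "(T((R, j) := v - 1)) (Q, i) < (T((R, j) := v - 1)) (Q', i)"
    if "i \<in> {1..c}" "Q \<in> {1..r}" "Q' \<in> {1..r}" "Q < Q'" for Q Q' i
    using col[OF that] up[of Q] that j v1 by auto
  ultimately show ?thesis unfolding D SSYT_def mem_Collect_eq by (intro conjI ballI impI)
qed

lemma rank_decrement:
  assumes T: "T \<in> SSYT r c t" and a: "cond1 r c T R v"
  shows "tab_rank r c (decrement c T R v) = tab_rank r c T - 1"
proof -
  define j where "j = Min (occurrences c T R v)"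
  have R: "R \<in> {1..r}" and v: "odd v" using a by (auto simp: cond1_def)
  have j: "j \<in> {1..c}" "T (R, j) = v"
    using Min_occurrences_free[OF T a] by (auto simp: j_def free_occurrences_def occurrences_def)
  have v1: "v \<ge> 1" using v by (cases v) auto
  let ?A = "{1..r} \<times> {1..c}"
  have mem: "(R, j) \<in> ?A" using R j by simp
  have "(\<Sum>x\<in>?A. (T((R, j) := v - 1)) x) = (v - 1) + (\<Sum>x\<in>?A - {(R, j)}. T x)"
    using mem by (subst sum.remove[of _ "(R, j)"]) auto
  moreover have "(\<Sum>x\<in>?A. T x) = v + (\<Sum>x\<in>?A - {(R, j)}. T x)"
    using mem j by (subst sum.remove[of _ "(R, j)"]) auto
  ultimately show ?thesis
    using v1 by (simp add: tab_rank_def decrement_def flip: j_def)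
qed

lemma tab_boundary_rank:
  assumes "T \<in> SSYT r c t" "U \<in> SSYT r c t" "tab_boundary r c t T U \<noteq> 0"
  shows "tab_rank r c U = tab_rank r c T - 1"
proof -
  obtain p where "p \<in> {(R, v). cond1 r c T R v}" "U = decrement c T (fst p) (snd p)"
    using assms(3) unfolding tab_boundary_apply[OF assms(2)]
    by (elim sum.not_neutral_contains_not_neutral) (auto split: if_splits)
  then show ?thesis using rank_decrement[OF assms(1)] by auto
qed

lemma boundary_graded_part:
  "boundary r c t ` graded_part r c t (k + 1) \<subseteq> graded_part r c t k"
proof clarify
  fix x assume x: "x \<in> graded_part r c t (k + 1)"
  have "tab_rank r c U = k" if U: "U \<in> SSYT r c t" and nz: "boundary r c t x U \<noteq> 0" for U
  proof -
    obtain T where T: "T \<in> SSYT r c t" "x T * tab_boundary r c t T U \<noteq> 0"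
      using nz unfolding boundary_apply[OF U] by (metis (no_types, lifting) sum.neutral)
    then have "x T \<noteq> 0" "tab_boundary r c t T U \<noteq> 0" by (metis mult_zero_left mult_zero_right)+
    then show ?thesis
      using tab_boundary_rank[OF T(1) U] x T(1) by (fastforce simp: graded_part_def)
  qed
  then show "boundary r c t x \<in> graded_part r c t k" by (simp add: graded_part_def)
qed

lemma cond1_decrement:
  assumes T: "T \<in> SSYT r c t" and a: "cond1 r c T R v" and b: "odd w"
  shows "cond1 r c (decrement c T R v) Q w \<longleftrightarrow> cond1 r c T Q w \<and> (Q, w) \<noteq> (R, v)"
    and "(Q, w) \<noteq> (R, v) \<Longrightarrow>
      occurrences c (decrement c T R v) Q w = occurrences c T Q w"
proof -
  define j where "j = Min (occurrences c T R v)"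
  have R: "R \<in> {1..r}" and v: "odd v" using a by (auto simp: cond1_def)
  have j: "j \<in> {1..c}" "T (R, j) = v" and jf: "j \<in> free_occurrences c T R v"
    using Min_occurrences_free[OF T a] by (auto simp: j_def free_occurrences_def occurrences_def)
  have v1: "v \<ge> 1" using v by (cases v) auto
  then have wv: "v - 1 \<noteq> w" using v b by auto
  have D: "decrement c T R v = T((R, j) := v - 1)" by (simp add: decrement_def j_def)
  have below: "T (Suc R, j) \<noteq> v" if "Suc R \<in> {1..r}"
  proof -
    have "T (R, j) < T (Suc R, j)" by (rule SSYT_col[OF T j(1) R that]) simp
    then show ?thesis using j by simp
  qed
  show occ: "occurrences c (decrement c T R v) Q w = occurrences c T Q w"
    if "(Q, w) \<noteq> (R, v)" using that wv j by (auto simp: D occurrences_def)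
  show "cond1 r c (decrement c T R v) Q w \<longleftrightarrow> cond1 r c T Q w \<and> (Q, w) \<noteq> (R, v)"
  proof (cases "Q \<in> {1..r}")
    case Q: True
    have free: "free_occurrences c (decrement c T R v) Q w = free_occurrences c T Q w - (if (Q, w) = (R, v) then {j} else {})"
    proof (cases "(Q, w) = (R, v)")
      case True
      then show ?thesis using R wv j by (auto simp: D free_occurrences_def occurrences_def)
    next
      case False
      have iff: "(Q = 1 \<or> (T((R, j) := v - 1)) (Q - 1, i) + 1 \<noteq> w) \<longleftrightarrow> (Q = 1 \<or> T (Q - 1, i) + 1 \<noteq> w)"
        if i: "i \<in> occurrences c T Q w" for i
      proof (cases "Q \<noteq> 1 \<and> Q - 1 = R \<and> i = j")
        case True
        then have "Q = Suc R" using Q by auto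
        then have "w \<noteq> v" using below Q i True by (auto simp: occurrences_def)
        moreover have "v + 1 \<noteq> w" using v b by auto
        ultimately show ?thesis using True j v1 by auto
      qed auto
      have "free_occurrences c (decrement c T R v) Q w =
        {i \<in> occurrences c T Q w. Q = 1 \<or> (T((R, j) := v - 1)) (Q - 1, i) + 1 \<noteq> w}"
        by (simp only: free_occurrences_def occ[OF False] flip: D)
      also have "\<dots> = free_occurrences c T Q w"
        unfolding free_occurrences_def using iff by (intro Collect_cong) blast
      finally show ?thesis using False by (metis Diff_empty)
    qed
    show ?thesis
    proof (cases "(Q, w) = (R, v)")
      case True
      have "finite (free_occurrences c T R v)" by (simp add: free_occurrences_def occurrences_def)
      then have "card (free_occurrences c T R v) = Suc (card (free_occurrences c T R v - {j}))"
        using jf by (metis card.remove)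
      then show ?thesis using True free a by (auto simp: cond1_def)
    next
      case False
      then show ?thesis using free occ by (auto simp: cond1_def)
    qed
  next
    case False
    then show ?thesis unfolding cond1_def by blast
  qed
qed

lemma decrement_commute:
  assumes T: "T \<in> SSYT r c t" and a: "cond1 r c T R v" and b: "cond1 r c T Q w"
    and ne: "(R, v) \<noteq> (Q, w)"
  shows "decrement c (decrement c T R v) Q w = decrement c (decrement c T Q w) R v"
proof -
  have odd: "odd v" "odd w" using a b by (auto simp: cond1_def)
  define i j where ij: "i = Min (occurrences c T R v)" "j = Min (occurrences c T Q w)"
  have "T (R, i) = v" "T (Q, j) = w"
    using Min_occurrences_free[OF T a] Min_occurrences_free[OF T b]
    by (auto simp: ij free_occurrences_def occurrences_def)
  then have "(R, i) \<noteq> (Q, j)" using ne by auto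
  moreover have "occurrences c (decrement c T R v) Q w = occurrences c T Q w"
    "occurrences c (decrement c T Q w) R v = occurrences c T R v"
    using cond1_decrement(2)[OF T a odd(2), of Q] cond1_decrement(2)[OF T b odd(1), of R] ne
    by auto
  then have "decrement c (decrement c T R v) Q w = T((R, i) := v - 1, (Q, j) := w - 1)"
    "decrement c (decrement c T Q w) R v = T((Q, j) := w - 1, (R, i) := v - 1)"
    by (simp_all add: decrement_def[of c _ Q w] decrement_def[of c _ R v] ij)
  ultimately show ?thesis by (simp add: fun_upd_twist)
qed

lemma sum_offdiag_bit:
  fixes f :: "'a \<Rightarrow> 'a \<Rightarrow> bit"
  assumes "finite A" "\<And>p q. p \<in> A \<Longrightarrow> q \<in> A \<Longrightarrow> p \<noteq> q \<Longrightarrow> f p q = f q p"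
  shows "(\<Sum>p\<in>A. \<Sum>q\<in>A - {p}. f p q) = 0"
  using assms
proof (induction A rule: finite_induct)
  case (insert a A)
  have "(\<Sum>q\<in>insert a A - {p}. f p q) = f p a + (\<Sum>q\<in>A - {p}. f p q)" if "p \<in> A" for p
  proof -
    have "insert a A - {p} = insert a (A - {p})" using insert.hyps that by auto
    then show ?thesis using insert.hyps by simp
  qed
  then have "(\<Sum>p\<in>A. \<Sum>q\<in>insert a A - {p}. f p q) = (\<Sum>p\<in>A. f p a)"
    using insert.IH insert.prems by (simp add: sum.distrib)
  moreover have "(\<Sum>q\<in>A. f a q) = (\<Sum>p\<in>A. f p a)"
    using insert.prems insert.hyps by (intro sum.cong) auto
  moreover have "insert a A - {a} = A" using insert.hyps by auto
  moreover have "y + y = 0" for y :: bit by (cases y) auto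
  ultimately show ?case using insert.hyps by simp
qed simp

lemma tab_boundary_squared:
  assumes T: "T \<in> SSYT r c t" and U: "U \<in> SSYT r c t"
  shows "(\<Sum>V\<in>SSYT r c t. tab_boundary r c t T V * tab_boundary r c t V U) = 0"
proof -
  let ?A = "{(R, v). cond1 r c T R v}"
  let ?D = "\<lambda>T p. decrement c T (fst p) (snd p)"
  have dec: "?D T p \<in> SSYT r c t" if "p \<in> ?A" for p
    using that decrement_SSYT[OF T] by auto
  have "(\<Sum>V\<in>SSYT r c t. tab_boundary r c t T V * tab_boundary r c t V U) =
    (\<Sum>V\<in>SSYT r c t. \<Sum>p\<in>?A. of_bool (V = ?D T p) * tab_boundary r c t V U)"
    by (intro sum.cong) (simp_all add: tab_boundary_apply[of _ r c t T] sum_distrib_right)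
  also have "\<dots> = (\<Sum>p\<in>?A. \<Sum>V\<in>SSYT r c t. of_bool (V = ?D T p) * tab_boundary r c t V U)"
    by (rule sum.swap)
  also have "\<dots> = (\<Sum>p\<in>?A. tab_boundary r c t (?D T p) U)"
  proof (rule sum.cong[OF refl])
    fix p assume "p \<in> ?A"
    have "(\<Sum>V\<in>SSYT r c t. of_bool (V = ?D T p) * tab_boundary r c t V U) =
      (\<Sum>V\<in>SSYT r c t. if V = ?D T p then tab_boundary r c t V U else 0)"
      by (intro sum.cong) auto
    then show "(\<Sum>V\<in>SSYT r c t. of_bool (V = ?D T p) * tab_boundary r c t V U) =
      tab_boundary r c t (?D T p) U"
      using dec[OF \<open>p \<in> ?A\<close>] by simp
  qed
  also have "\<dots> = (\<Sum>p\<in>?A. \<Sum>q\<in>?A - {p}. of_bool (U = ?D (?D T p) q))"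
  proof (rule sum.cong[OF refl])
    fix p assume p: "p \<in> ?A"
    then have cp: "cond1 r c T (fst p) (snd p)" by auto
    have "{(R, v). cond1 r c (?D T p) R v} = ?A - {p}"
      using cond1_decrement(1)[OF T cp] by (auto simp: cond1_def)
    then show "tab_boundary r c t (?D T p) U = (\<Sum>q\<in>?A - {p}. of_bool (U = ?D (?D T p) q))"
      by (simp add: tab_boundary_apply[OF U])
  qed
  also have "\<dots> = 0"
  proof (rule sum_offdiag_bit)
    fix p q assume "p \<in> ?A" "q \<in> ?A" "p \<noteq> q"
    then have "?D (?D T p) q = ?D (?D T q) p"
      by (intro decrement_commute[OF T]) (auto simp: prod_eq_iff)
    then show "of_bool (U = ?D (?D T p) q) = (of_bool (U = ?D (?D T q) p) :: bit)" by simp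
  qed simp
  finally show ?thesis .
qed

lemma boundary_boundary: "boundary r c t (boundary r c t x) = \<zero>\<^bsub>chain_space r c t\<^esub>"
proof (rule PiE_ext)
  show "boundary r c t (boundary r c t x) \<in> SSYT r c t \<rightarrow>\<^sub>E UNIV"
    using boundary_closed by (simp add: chain_space_simps)
  show "\<zero>\<^bsub>chain_space r c t\<^esub> \<in> SSYT r c t \<rightarrow>\<^sub>E UNIV" by (simp add: chain_space_simps)
  fix U assume U: "U \<in> SSYT r c t"
  have "boundary r c t (boundary r c t x) U =
    (\<Sum>V\<in>SSYT r c t. \<Sum>T\<in>SSYT r c t. x T * (tab_boundary r c t T V * tab_boundary r c t V U))"
    unfolding boundary_apply[OF U]
    by (intro sum.cong) (simp_all add: boundary_apply sum_distrib_right mult.assoc)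
  also have "\<dots> = (\<Sum>T\<in>SSYT r c t. x T *
      (\<Sum>V\<in>SSYT r c t. tab_boundary r c t T V * tab_boundary r c t V U))"
    by (subst sum.swap) (simp only: sum_distrib_left)
  also have "\<dots> = 0" using tab_boundary_squared[OF _ U] by (simp cong: sum.cong)
  finally show "boundary r c t (boundary r c t x) U = \<zero>\<^bsub>chain_space r c t\<^esub> U"
    using U by (simp add: chain_space_simps)
qed

lemma boundary_module_hom: "boundary r c t \<in> LinearCombinations.module_hom F2 (chain_space r c t) (chain_space r c t)"
proof -
  let ?C = "chain_space r c t"
  interpret vectorspace F2 ?C by (rule vectorspace_chain_space)
  have ext: "boundary r c t x = y" if "y \<in> carrier ?C" "\<And>U. U \<in> SSYT r c t \<Longrightarrow> boundary r c t x U = y U"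
    for x y
    by (rule PiE_ext[where k = "SSYT r c t" and s = "\<lambda>_. UNIV"])
      (use that boundary_closed[of r c t x] in \<open>simp_all add: chain_space_simps\<close>)
  have "boundary r c t (x \<oplus>\<^bsub>?C\<^esub> y) = boundary r c t x \<oplus>\<^bsub>?C\<^esub> boundary r c t y" for x y
    by (rule ext) (simp_all add: boundary_apply chain_space_simps(3) sum.distrib distrib_right
      chain_space_simps(1))
  moreover have "boundary r c t (a \<odot>\<^bsub>?C\<^esub> x) = a \<odot>\<^bsub>?C\<^esub> boundary r c t x" for a x
    by (rule ext) (simp_all add: boundary_apply chain_space_simps(4) sum_distrib_left mult.assoc
      chain_space_simps(1))
  ultimately show ?thesis by (auto simp: LinearCombinations.module_hom_def)
qed

lemma submodule_abelian_subgroup: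
  assumes "submodule K W V"
  shows "abelian_subgroup W V"
proof -
  interpret W: submodule K W V by fact
  interpret Module.module K V by (rule W.module)
  have "subgroup W (add_monoid V)"
  proof (rule group.subgroupI)
    show "group (add_monoid V)" by (rule M.a_group)
    show "W \<subseteq> carrier (add_monoid V)" "W \<noteq> {}" using W.subset W.zero_closed by (simp, blast)
    fix x y assume x: "x \<in> W" and y: "y \<in> W"
    then show "x \<otimes>\<^bsub>add_monoid V\<^esub> y \<in> W" by simp
    have xV: "x \<in> carrier V" using x W.subset by auto
    have "(\<ominus>\<^bsub>K\<^esub> \<one>\<^bsub>K\<^esub>) \<odot>\<^bsub>V\<^esub> x \<in> W" using x by (intro W.smult_closed) auto
    then have "\<ominus>\<^bsub>V\<^esub> x \<in> W" using xV by (simp add: smult_l_minus)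
    then show "inv\<^bsub>add_monoid V\<^esub> x \<in> W" by (simp add: a_inv_def)
  qed
  then show ?thesis
    by (intro abelian_subgroupI3 additive_subgroup.intro) (auto intro: M.abelian_group_axioms)
qed

lemma vectorspace_quotient_module:
  assumes "vectorspace K V" and W: "submodule K W V"
  shows "vectorspace K (quotient_module V W)"
proof -
  interpret vectorspace K V by fact
  interpret W: submodule K W V by fact
  interpret S: abelian_subgroup W V by (rule submodule_abelian_subgroup[OF W])
  let ?Q = "quotient_module V W"
  have add: "(W +>\<^bsub>V\<^esub> x) \<oplus>\<^bsub>?Q\<^esub> (W +>\<^bsub>V\<^esub> y) = W +>\<^bsub>V\<^esub> (x \<oplus>\<^bsub>V\<^esub> y)"
    if "x \<in> carrier V" "y \<in> carrier V" for x y
    using that S.a_rcos_sum by (simp add: quotient_module_def)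
  have carrE: "\<exists>x\<in>carrier V. X = W +>\<^bsub>V\<^esub> x" if "X \<in> carrier ?Q" for X
    using that by (auto simp: quotient_module_def A_RCOSETS_def RCOSETS_def a_r_coset_def)
  have carrI: "W +>\<^bsub>V\<^esub> x \<in> carrier ?Q" if "x \<in> carrier V" for x
    using that by (auto simp: quotient_module_def A_RCOSETS_def RCOSETS_def a_r_coset_def)
  have zero: "\<zero>\<^bsub>?Q\<^esub> = W +>\<^bsub>V\<^esub> \<zero>\<^bsub>V\<^esub>"
    using W.subset by (simp add: quotient_module_def)
  have ab: "abelian_group ?Q"
  proof (rule abelian_groupI)
    show "\<zero>\<^bsub>?Q\<^esub> \<in> carrier ?Q" by (simp add: zero carrI)
  next
    fix X Y assume "X \<in> carrier ?Q" "Y \<in> carrier ?Q"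
    then show "X \<oplus>\<^bsub>?Q\<^esub> Y \<in> carrier ?Q" "X \<oplus>\<^bsub>?Q\<^esub> Y = Y \<oplus>\<^bsub>?Q\<^esub> X"
      using carrE[of X] carrE[of Y] by (auto simp: add carrI M.a_comm)
  next
    fix X Y Z assume "X \<in> carrier ?Q" "Y \<in> carrier ?Q" "Z \<in> carrier ?Q"
    then show "X \<oplus>\<^bsub>?Q\<^esub> Y \<oplus>\<^bsub>?Q\<^esub> Z = X \<oplus>\<^bsub>?Q\<^esub> (Y \<oplus>\<^bsub>?Q\<^esub> Z)"
      using carrE[of X] carrE[of Y] carrE[of Z] by (auto simp: add M.a_assoc)
  next
    fix X assume "X \<in> carrier ?Q"
    then obtain x where x: "x \<in> carrier V" "X = W +>\<^bsub>V\<^esub> x" using carrE by blast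
    then show "\<zero>\<^bsub>?Q\<^esub> \<oplus>\<^bsub>?Q\<^esub> X = X" by (simp add: zero add)
    show "\<exists>Y\<in>carrier ?Q. Y \<oplus>\<^bsub>?Q\<^esub> X = \<zero>\<^bsub>?Q\<^esub>"
      using x by (intro bexI[of _ "W +>\<^bsub>V\<^esub> (\<ominus>\<^bsub>V\<^esub> x)"]) (simp_all add: zero add carrI M.l_neg)
  qed
  have smult: "a \<odot>\<^bsub>?Q\<^esub> (W +>\<^bsub>V\<^esub> x) = W +>\<^bsub>V\<^esub> (a \<odot>\<^bsub>V\<^esub> x)"
    if a: "a \<in> carrier K" and x: "x \<in> carrier V" for a x
  proof -
    have eq: "W +>\<^bsub>V\<^esub> (a \<odot>\<^bsub>V\<^esub> y) = W +>\<^bsub>V\<^esub> (a \<odot>\<^bsub>V\<^esub> x)" if y: "y \<in> W +>\<^bsub>V\<^esub> x" for y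
    proof -
      obtain w where w: "w \<in> W" "y = w \<oplus>\<^bsub>V\<^esub> x"
        using y by (auto simp: a_r_coset_def r_coset_def)
      then have "a \<odot>\<^bsub>V\<^esub> y = (a \<odot>\<^bsub>V\<^esub> w) \<oplus>\<^bsub>V\<^esub> (a \<odot>\<^bsub>V\<^esub> x)"
        using a x W.subset by (auto intro: smult_r_distr)
      then have "a \<odot>\<^bsub>V\<^esub> y \<in> W +>\<^bsub>V\<^esub> (a \<odot>\<^bsub>V\<^esub> x)"
        using W.smult_closed[OF a w(1)] by (auto simp: a_r_coset_def r_coset_def)
      then show ?thesis using a x M.a_repr_independence[OF _ _ S.a_subgroup] by auto
    qed
    have "a \<odot>\<^bsub>?Q\<^esub> (W +>\<^bsub>V\<^esub> x) = (\<Union>y\<in>W +>\<^bsub>V\<^esub> x. W +>\<^bsub>V\<^esub> (a \<odot>\<^bsub>V\<^esub> y))"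
      by (simp add: quotient_module_def)
    also have "\<dots> = (\<Union>y\<in>W +>\<^bsub>V\<^esub> x. W +>\<^bsub>V\<^esub> (a \<odot>\<^bsub>V\<^esub> x))"
      by (rule SUP_cong[OF refl eq])
    also have "\<dots> = W +>\<^bsub>V\<^esub> (a \<odot>\<^bsub>V\<^esub> x)"
      using S.a_rcos_self[OF x] by blast
    finally show ?thesis .
  qed
  have "Module.module K ?Q"
  proof (rule moduleI)
    show "cring K" by (rule R.is_cring)
    show "abelian_group ?Q" by (rule ab)
  next
    fix a X assume "a \<in> carrier K" "X \<in> carrier ?Q"
    then show "a \<odot>\<^bsub>?Q\<^esub> X \<in> carrier ?Q" using carrE[of X] by (auto simp: smult carrI)
  next
    fix a b X assume "a \<in> carrier K" "b \<in> carrier K" "X \<in> carrier ?Q"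
    then show "(a \<oplus>\<^bsub>K\<^esub> b) \<odot>\<^bsub>?Q\<^esub> X = a \<odot>\<^bsub>?Q\<^esub> X \<oplus>\<^bsub>?Q\<^esub> b \<odot>\<^bsub>?Q\<^esub> X"
      using carrE[of X] by (auto simp: smult add smult_l_distr)
  next
    fix a X Y assume "a \<in> carrier K" "X \<in> carrier ?Q" "Y \<in> carrier ?Q"
    then show "a \<odot>\<^bsub>?Q\<^esub> (X \<oplus>\<^bsub>?Q\<^esub> Y) = a \<odot>\<^bsub>?Q\<^esub> X \<oplus>\<^bsub>?Q\<^esub> a \<odot>\<^bsub>?Q\<^esub> Y"
      using carrE[of X] carrE[of Y] by (auto simp: smult add smult_r_distr)
  next
    fix a b X assume "a \<in> carrier K" "b \<in> carrier K" "X \<in> carrier ?Q"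
    then show "(a \<otimes>\<^bsub>K\<^esub> b) \<odot>\<^bsub>?Q\<^esub> X = a \<odot>\<^bsub>?Q\<^esub> (b \<odot>\<^bsub>?Q\<^esub> X)"
      using carrE[of X] by (auto simp: smult smult_assoc1)
  next
    fix X assume "X \<in> carrier ?Q"
    then show "\<one>\<^bsub>K\<^esub> \<odot>\<^bsub>?Q\<^esub> X = X" using carrE[of X] by (auto simp: smult)
  qed
  then show ?thesis using field_axioms by (simp add: vectorspace_def)
qed

lemma vectorspace_homology: "vectorspace F2 (homology r c t)"
proof -
  let ?C = "chain_space r c t"
  interpret vectorspace F2 ?C by (rule vectorspace_chain_space)
  interpret d: mod_hom F2 ?C ?C "boundary r c t"
    by unfold_locales (rule boundary_module_hom)
  have ker: "d.ker = cycles r c t" by (auto simp: d.ker_def cycles_def)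
  have im: "d.im = boundaries r c t" by (simp add: d.im_def boundaries_def)
  have sk: "submodule F2 (cycles r c t) ?C" using d.ker_is_submodule ker by simp
  have si: "submodule F2 (boundaries r c t) ?C" using d.im_is_submodule im by simp
  have vs: "vectorspace F2 (?C\<lparr>carrier := cycles r c t\<rparr>)"
    using submodule_is_module[OF sk] field_F2 by (simp add: vectorspace_def)
  have "boundaries r c t \<subseteq> cycles r c t"
    by (auto simp: boundaries_def cycles_def boundary_boundary)
  then have "submodule F2 (boundaries r c t) (?C\<lparr>carrier := cycles r c t\<rparr>)"
    using si vs by (simp add: submodule_def vectorspace_def)
  then show ?thesis unfolding homology_def by (rule vectorspace_quotient_module[OF vs])
qed

end

theory Submission
  imports Defs
begin

text \<open>
  Call \<open>(R, v)\<close> with \<open>v\<close> odd active if \<open>(R, v)\<close> satisfies condition (1) or \<open>(R, v - 1)\<close> satisfies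
  condition (2). A term of the boundary turns one active pair from type (1) into type (2) and
  leaves all the others as they were, so the complex is a direct sum of cubes indexed by sets of
  active pairs. Raising at one chosen active pair contracts every cube of positive dimension; the
  cubes of dimension 0 are the unmatched tableaux, which are therefore a basis of the homology. In
  an unmatched tableau every even entry that is not in the last row has its successor directly
  below, and the free occurrences of odd values in each row are even in number; this fixes the
  parity of each row sum and makes the rank even.
\<close>

section \<open>Active pairs and their behaviour under lowering and raising\<close>

definition active :: "nat \<Rightarrow> nat \<Rightarrow> nat \<Rightarrow> tableau \<Rightarrow> (nat \<times> nat) set" where
  "active r c t T = {(R, v). odd v \<and> (cond1 r c T R v \<or> cond2 r c t T R (v - 1))}"

lemma finite_occurrences [simp]: "finite (occurrences c T R v)"
  by (simp add: occurrences_def)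

lemma finite_free_occurrences [simp]: "finite (free_occurrences c T R v)"
  by (simp add: free_occurrences_def)

lemma cond1_iff: "cond1 r c T R v \<longleftrightarrow> R \<in> {1..r} \<and> odd v \<and> odd (card (free_occurrences c T R v))"
  by (auto simp: cond1_def free_occurrences_def)

text \<open>Evenness of the number of free \<open>v\<close> is the negation of (1) at
  \<open>(R, v)\<close>, so an active pair has exactly one of the two types.\<close>

lemma cond2_iff:
  assumes "odd v"
  shows "cond2 r c t T R (v - 1) \<longleftrightarrow> R \<in> {1..r} \<and> v \<le> r + t - 1 \<and> occurrences c T R (v - 1) \<noteq> {} \<and>
    (R = r \<or> T (R + 1, Max (occurrences c T R (v - 1))) \<noteq> v) \<and> \<not> cond1 r c T R v"
proof -
  have "v - 1 + 1 = v" "even (v - 1)" "v - 1 < r + t - 1 \<longleftrightarrow> v \<le> r + t - 1"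
    using assms by (auto elim: oddE)
  then show ?thesis using assms by (auto simp: cond2_def cond1_iff simp del: One_nat_def)
qed

text \<open>Entries to the right of the leftmost \<open>v\<close> are at least \<open>v\<close>, so
  once lowered that cell is the rightmost \<open>v - 1\<close>, which is where
  \<open>increment\<close> acts.\<close>

lemma Max_occurrences_decrement:
  assumes T: "T \<in> SSYT r c t" and a: "cond1 r c T R v"
  shows "Max (occurrences c (decrement c T R v) R (v - 1)) = Min (occurrences c T R v)"
    and "Min (occurrences c T R v) \<in> occurrences c (decrement c T R v) R (v - 1)"
proof -
  define j where "j = Min (occurrences c T R v)"
  have R: "R \<in> {1..r}" and v: "odd v" using a by (auto simp: cond1_def)
  have j: "j \<in> {1..c}" "T (R, j) = v"
    using Min_occurrences_free[OF T a] by (auto simp: j_def free_occurrences_def occurrences_def)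
  have D: "decrement c T R v = T((R, j) := v - 1)" by (simp add: decrement_def j_def)
  show mem: "Min (occurrences c T R v) \<in> occurrences c (decrement c T R v) R (v - 1)"
    unfolding j_def[symmetric] D using j by (simp add: occurrences_def)
  show "Max (occurrences c (decrement c T R v) R (v - 1)) = Min (occurrences c T R v)"
  proof (rule Max_eqI)
    fix i assume "i \<in> occurrences c (decrement c T R v) R (v - 1)"
    then have i: "i \<in> {1..c}" "i = j \<or> T (R, i) = v - 1"
      by (auto simp: D occurrences_def split: if_splits)
    have "i \<le> j"
    proof (rule ccontr)
      assume "\<not> i \<le> j"
      then have "T (R, j) \<le> T (R, i)" "T (R, i) = v - 1"
        using SSYT_row[OF T R j(1) i(1)] i by auto
      then show False using j v by (auto elim: oddE)
    qed
    then show "i \<le> Min (occurrences c T R v)" by (simp add: j_def)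
  qed (use mem in auto)
qed

lemma increment_decrement:
  assumes "T \<in> SSYT r c t" and a: "cond1 r c T R v"
  shows "increment c (decrement c T R v) R (v - 1) = T"
proof -
  have "odd v" "T (R, Min (occurrences c T R v)) = v"
    using a Min_occurrences_free[OF assms] by (auto simp: cond1_def free_occurrences_def occurrences_def)
  then show ?thesis
    unfolding increment_def Max_occurrences_decrement[OF assms] by (auto simp: decrement_def elim: oddE)
qed

text \<open>At \<open>(R, v)\<close> the parity turns even and the entry below the new
  \<open>v - 1\<close>, if any, exceeds \<open>v\<close>, which gives (2). For any other pair the
  positions of \<open>w - 1\<close> in row \<open>Q\<close> stay the same, by parity when
  \<open>Q = R\<close>.\<close>

lemma cond2_decrement:
  assumes T: "T \<in> SSYT r c t" and a: "cond1 r c T R v" and w: "odd w"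
  shows "cond2 r c t (decrement c T R v) Q (w - 1) \<longleftrightarrow> cond2 r c t T Q (w - 1) \<or> (Q, w) = (R, v)"
proof -
  define j where "j = Min (occurrences c T R v)"
  have R: "R \<in> {1..r}" and v: "odd v" using a by (auto simp: cond1_def)
  have j: "j \<in> {1..c}" "T (R, j) = v" and free: "R = 1 \<or> T (R - 1, j) + 1 \<noteq> v"
    using Min_occurrences_free[OF T a] by (auto simp: j_def free_occurrences_def occurrences_def)
  have D: "decrement c T R v = T((R, j) := v - 1)" by (simp add: decrement_def j_def)
  have vw: "v - 1 \<noteq> w" "v \<noteq> w - 1" using v w by (auto elim!: oddE) presburger+
  note c1 = cond1_decrement(1)[OF T a w, of Q]
  show ?thesis
  proof (cases "(Q, w) = (R, v)")
    case True
    have "v \<le> r + t - 1" using SSYT_PiE[OF T] R j by fastforce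
    moreover have "R = r \<or> decrement c T R v (R + 1, j) \<noteq> v"
      using SSYT_col[OF T j(1) R, of "R + 1"] R j by (auto simp: D)
    ultimately show ?thesis
      using True R Max_occurrences_decrement[OF T a] c1
      unfolding cond2_iff[OF w] by (auto simp flip: j_def)
  next
    case False
    define m where "m = Max (occurrences c T Q (w - 1))"
    have occ: "occurrences c (decrement c T R v) Q (w - 1) = occurrences c T Q (w - 1)"
      using False vw v w j by (auto simp: D occurrences_def elim!: oddE)
    \<comment> \<open>The change matters here only if \<open>(R, j)\<close> lies directly below the
      rightmost \<open>w - 1\<close> of row \<open>Q\<close>. Then freeness of \<open>j\<close>
      excludes \<open>v = w\<close> and parity excludes \<open>v - 1 = w\<close>, so the cell
      differs from \<open>w\<close> before and after.\<close>
    have below: "decrement c T R v (Q + 1, m) \<noteq> w \<longleftrightarrow> T (Q + 1, m) \<noteq> w"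
      if "occurrences c T Q (w - 1) \<noteq> {}" "Q \<in> {1..r}"
    proof (cases "(Q + 1, m) = (R, j)")
      case True
      have "m \<in> occurrences c T Q (w - 1)" unfolding m_def using that by (intro Max_in) auto
      then have "T (Q, m) = w - 1" by (simp add: occurrences_def)
      then have "v \<noteq> w" using True free v that by (auto elim!: oddE)
      then show ?thesis using True vw j by (auto simp: D)
    qed (auto simp: D)
    show ?thesis
      using False c1 below unfolding cond2_iff[OF w] occ m_def[symmetric] by blast
  qed
qed

text \<open>The pair lost in (1) is the pair gained in (2), so the active set is constant along
  boundary terms.\<close>

lemma active_decrement:
  assumes "T \<in> SSYT r c t" "cond1 r c T R v"
  shows "active r c t (decrement c T R v) = active r c t T"
  using cond1_decrement(1)[OF assms] cond2_decrement[OF assms] assms(2)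
  by (auto simp: active_def)

text \<open>Raising the rightmost \<open>v - 1\<close> keeps the row sorted, and (2) excludes
  \<open>v\<close> just below it, so the column stays strict. Any entry above the raised cell is
  less than \<open>v - 1\<close>, so the cell is a free \<open>v\<close> and makes the even number
  of free \<open>v\<close> odd. It is also the leftmost \<open>v\<close>, hence lowering undoes the
  move.\<close>

lemma increment_active:
  assumes T: "T \<in> SSYT r c t" and v: "odd v" and a: "cond2 r c t T R (v - 1)"
  defines "U \<equiv> increment c T R (v - 1)"
  shows "U \<in> SSYT r c t" and "cond1 r c U R v" and "decrement c U R v = T"
proof -
  define k where "k = Max (occurrences c T R (v - 1))"
  have v1: "v = v - 1 + 1" using v by (auto elim: oddE)
  have R: "R \<in> {1..r}" and vle: "v \<le> r + t - 1" and ne: "occurrences c T R (v - 1) \<noteq> {}"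
    and bel: "R = r \<or> T (R + 1, k) \<noteq> v" and n1: "\<not> cond1 r c T R v"
    using a unfolding cond2_iff[OF v] k_def by auto
  have "k \<in> occurrences c T R (v - 1)" unfolding k_def using ne by (intro Max_in) auto
  then have k: "k \<in> {1..c}" "T (R, k) = v - 1" by (auto simp: occurrences_def)
  have U: "U = T((R, k) := v)" using v1 by (simp add: U_def increment_def k_def)
  note PiE = SSYT_PiE[OF T] and row = SSYT_row[OF T] and col = SSYT_col[OF T]
  have right: "v \<le> T (R, i)" if "i \<in> {1..c}" "k < i" for i
  proof -
    have "v - 1 \<le> T (R, i)" using row[OF R k(1) that(1)] that k by simp
    moreover have "T (R, i) \<noteq> v - 1"
    proof
      assume "T (R, i) = v - 1"
      then have "i \<in> occurrences c T R (v - 1)" using that by (simp add: occurrences_def)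
      then have "i \<le> k" unfolding k_def by (intro Max_ge) auto
      then show False using that by simp
    qed
    ultimately show ?thesis by simp
  qed
  have down: "v < T (Q, k)" if "Q \<in> {1..r}" "R < Q" for Q
  proof -
    have R1: "R + 1 \<in> {1..r}" using that R by auto
    have "v - 1 < T (R + 1, k)" using col[OF k(1) R R1] k by simp
    then have "v < T (R + 1, k)" using bel R1 by auto
    moreover have "T (R + 1, k) \<le> T (Q, k)"
      using col[OF k(1) R1 that(1)] that by (cases "Q = R + 1") (auto intro!: less_imp_le)
    ultimately show ?thesis by simp
  qed
  have "T((R, k) := v) \<in> ({1..r} \<times> {1..c}) \<rightarrow>\<^sub>E {0..r + t - 1}"
    using PiE R k vle by (auto simp: PiE_iff extensional_def)
  moreover have "(T((R, k) := v)) (Q, i) \<le> (T((R, k) := v)) (Q, i')"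
    if "Q \<in> {1..r}" "i \<in> {1..c}" "i' \<in> {1..c}" "i \<le> i'" for Q i i'
    using row[OF that] right[of i'] that k by (auto simp: le_less)
  moreover have "(T((R, k) := v)) (Q, i) < (T((R, k) := v)) (Q', i)"
    if "i \<in> {1..c}" "Q \<in> {1..r}" "Q' \<in> {1..r}" "Q < Q'" for Q Q' i
    using col[OF that] down[of Q'] that k v1 by auto
  ultimately show "U \<in> SSYT r c t" unfolding U SSYT_def mem_Collect_eq by (intro conjI ballI impI)
  have occ: "occurrences c U R v = insert k (occurrences c T R v)"
    using k by (auto simp: U occurrences_def)
  have "R = 1 \<or> T (R - 1, k) + 1 \<noteq> v"
  proof (cases "R = 1")
    case False
    then have "R - 1 \<in> {1..r}" "R - 1 < R" using R by auto
    then show ?thesis using col[OF k(1) _ R, of "R - 1"] k by auto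
  qed simp
  then have "free_occurrences c U R v = insert k (free_occurrences c T R v)"
    using R unfolding free_occurrences_def occ by (auto simp: U)
  moreover have "k \<notin> free_occurrences c T R v"
    using k v1 by (auto simp: free_occurrences_def occurrences_def)
  ultimately show "cond1 r c U R v" using n1 R v by (simp add: cond1_iff)
  have "Min (occurrences c U R v) = k"
  proof (rule Min_eqI)
    fix i assume "i \<in> occurrences c U R v"
    then have i: "i \<in> {1..c}" "i = k \<or> T (R, i) = v" 
      using k unfolding occ by (auto simp: occurrences_def)
    show "k \<le> i" using row[OF R i(1) k(1)] i k v1 by (cases "k \<le> i") auto
  qed (auto simp: occ)
  then show "decrement c U R v = T" using k by (auto simp: decrement_def U)
qed

text \<open>Reduces to \<open>decrement_commute\<close>: as \<open>T\<close> is the raised tableau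
  \<open>U\<close> lowered at \<open>(R, v)\<close>, lowering \<open>T\<close> at
  \<open>(Q, w)\<close> equals lowering \<open>U\<close> at \<open>(Q, w)\<close> and then at
  \<open>(R, v)\<close>, and the increment undoes the last step.\<close>

lemma increment_decrement_commute:
  assumes T: "T \<in> SSYT r c t" and v: "odd v" and a: "cond2 r c t T R (v - 1)"
    and b: "cond1 r c T Q w"
  shows "increment c (decrement c T Q w) R (v - 1) = decrement c (increment c T R (v - 1)) Q w"
proof -
  define U where "U = increment c T R (v - 1)"
  note U = increment_active[OF T v a, folded U_def]
  have w: "odd w" using b by (simp add: cond1_def)
  have ne: "(R, v) \<noteq> (Q, w)" and bU: "cond1 r c U Q w"
    using cond1_decrement(1)[OF U(1,2) w, of Q] b U(3) by auto
  have "decrement c T Q w = decrement c (decrement c U Q w) R v"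
    using decrement_commute[OF U(1,2) bU ne] U(3) by simp
  moreover have "cond1 r c (decrement c U Q w) R v"
    using cond1_decrement(1)[OF U(1) bU v, of R] U(2) ne by auto
  ultimately show ?thesis
    using increment_decrement[OF decrement_SSYT[OF U(1) bU]] U_def by simp
qed

lemma unmatched_iff_active: "T \<in> unmatched r c t \<longleftrightarrow> T \<in> SSYT r c t \<and> active r c t T = {}"
proof -
  have "(R, i) \<in> active r c t T" if "cond1 r c T R i" for R i
    using that by (simp add: active_def cond1_def)
  moreover have "(R, i + 1) \<in> active r c t T" if "cond2 r c t T R i" for R i
    using that by (auto simp: active_def cond2_def)
  moreover have "\<exists>R i. cond1 r c T R i \<or> cond2 r c t T R i" if "p \<in> active r c t T" for p
    using that unfolding active_def by blast
  ultimately show ?thesis unfolding unmatched_iff by blast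
qed

section \<open>Even rank of unmatched tableaux\<close>

lemma sum_pred_eq_choose_2: "(\<Sum>R\<in>{1..r}. R - 1) = r choose 2"
proof (induction r)
  case (Suc r)
  have "{1..Suc r} = insert (Suc r) {1..r}" by auto
  then show ?case using Suc by (simp add: numeral_2_eq_2)
qed (simp add: numeral_2_eq_2)

text \<open>Since (1) fails for every odd \<open>v\<close>, each value contributes an even number of
  free occurrences; these sets are disjoint.\<close>

lemma even_card_free_odd:
  assumes U: "T \<in> unmatched r c t" and R: "R \<in> {1..r}"
  shows "even (card {j \<in> {1..c}. odd (T (R, j)) \<and> (R = 1 \<or> T (R - 1, j) + 1 \<noteq> T (R, j))})"
proof -
  let ?V = "{v \<in> {0..r + t - 1}. odd v}"
  have T: "T \<in> SSYT r c t" and n1: "\<not> cond1 r c T R v" for v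
    using U by (auto simp: unmatched_iff)
  have eq: "{j \<in> {1..c}. odd (T (R, j)) \<and> (R = 1 \<or> T (R - 1, j) + 1 \<noteq> T (R, j))} =
    (\<Union>v\<in>?V. free_occurrences c T R v)"
    using SSYT_PiE[OF T] R by (fastforce simp: free_occurrences_def occurrences_def)
  have "card (\<Union>v\<in>?V. free_occurrences c T R v) = (\<Sum>v\<in>?V. card (free_occurrences c T R v))"
    by (rule card_UN_disjoint) (auto simp: free_occurrences_def occurrences_def)
  moreover have "even (card (free_occurrences c T R v))" if "v \<in> ?V" for v
    using n1[of v] R that by (simp add: cond1_iff)
  then have "even (\<Sum>v\<in>?V. card (free_occurrences c T R v))" by (rule dvd_sum)
  ultimately show ?thesis unfolding eq by simp
qed

text \<open>For an even entry, failure of (2) puts its successor \<open>v\<close> below the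
  rightmost occurrence \<open>m\<close> of that entry. The entry below \<open>j\<close> exceeds
  \<open>T (R, j)\<close> and, by row order, is at most the one below \<open>m\<close>, so it is
  \<open>v\<close> too.\<close>

lemma unmatched_below_even_iff:
  assumes U: "T \<in> unmatched r c t" and R: "R \<in> {1..r}" "R + 1 \<in> {1..r}" and j: "j \<in> {1..c}"
  shows "odd (T (R + 1, j)) \<and> T (R, j) + 1 = T (R + 1, j) \<longleftrightarrow> even (T (R, j))"
proof
  assume e: "even (T (R, j))"
  define v where "v = T (R, j) + 1"
  define m where "m = Max (occurrences c T R (v - 1))"
  have T: "T \<in> SSYT r c t" and n: "\<not> cond1 r c T R v" "\<not> cond2 r c t T R (v - 1)"
    using U by (auto simp: unmatched_iff)
  have v: "odd v" using e by (simp add: v_def)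
  have jo: "j \<in> occurrences c T R (v - 1)" using j by (simp add: occurrences_def v_def)
  then have "m \<in> occurrences c T R (v - 1)" and jm: "j \<le> m"
    unfolding m_def by (auto intro: Max_in)
  then have m: "m \<in> {1..c}" by (simp add: occurrences_def)
  have lt: "T (R, j) < T (R + 1, j)" by (rule SSYT_col[OF T j R]) simp
  moreover have "T (R + 1, j) \<le> r + t - 1" using SSYT_PiE[OF T] R j by fastforce
  \<comment> \<open>Failure of (1) gives the parity clause of (2), the larger entry below
    \<open>j\<close> gives the bound on \<open>v\<close>, and \<open>R\<close> is not the last row.
    Only the clause on the cell below \<open>m\<close> can fail.\<close>
  ultimately have "T (R + 1, m) = v"
    using n jo R unfolding cond2_iff[OF v] by (auto simp: v_def m_def)
  then have "T (R + 1, j) = T (R, j) + 1"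
    using SSYT_row[OF T R(2) j m jm] lt by (simp add: v_def)
  then show "odd (T (R + 1, j)) \<and> T (R, j) + 1 = T (R + 1, j)" using e by simp
qed presburger

text \<open>An odd entry of row \<open>R + 1\<close> is either free, and there are evenly many of
  these, or the successor of the entry above; the latter lie exactly below the even entries of row
  \<open>R\<close>. So the numbers of odd entries in the two rows add up to \<open>c\<close> modulo
  2, and induction applies.\<close>

lemma unmatched_row_parity:
  assumes U: "T \<in> unmatched r c t"
  shows "R \<in> {1..r} \<Longrightarrow> even ((\<Sum>j\<in>{1..c}. T (R, j)) + c * (R - 1))"
proof (induction R)
  case (Suc R)
  let ?O = "\<lambda>R. {j \<in> {1..c}. odd (T (R, j))}"
  let ?F = "\<lambda>R. {j \<in> {1..c}. odd (T (R, j)) \<and> (R = 1 \<or> T (R - 1, j) + 1 \<noteq> T (R, j))}"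
  have par: "even (\<Sum>j\<in>{1..c}. T (Q, j)) \<longleftrightarrow> even (card (?O Q))" for Q
    by (simp add: even_sum_iff)
  note F = even_card_free_odd[OF U Suc.prems]
  show ?case
  proof (cases "R = 0")
    \<comment> \<open>In the first row every occurrence is free.\<close>
    case True
    then show ?thesis using F par[of "Suc R"] by simp
  next
    case False
    then have R: "R \<in> {1..r}" "R + 1 \<in> {1..r}" using Suc.prems by auto
    have iff: "odd (T (Suc R, j)) \<and> T (R, j) + 1 = T (Suc R, j) \<longleftrightarrow> even (T (R, j))"
      if "j \<in> {1..c}" for j
      using unmatched_below_even_iff[OF U R that] by simp
    have "?O (Suc R) = ?F (Suc R) \<union> ({1..c} - ?O R)" "?F (Suc R) \<inter> ({1..c} - ?O R) = {}"
      using iff False by (simp_all add: set_eq_iff) blast+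
    then have "card (?O (Suc R)) = card (?F (Suc R)) + card ({1..c} - ?O R)"
      by (simp add: card_Un_disjoint)
    also have "card ({1..c} - ?O R) = c - card (?O R)"
      by (subst card_Diff_subset) auto
    finally have "card (?O (Suc R)) = card (?F (Suc R)) + (c - card (?O R))" .
    moreover have "card (?O R) \<le> card {1..c}" by (rule card_mono) auto
    ultimately have "card (?O (Suc R)) + card (?O R) = card (?F (Suc R)) + c" by simp
    then have "even (card (?O (Suc R)) + card (?O R)) \<longleftrightarrow> even c" using F by simp
    moreover have "even (card (?O R) + c * (R - 1))" using Suc.IH[OF R(1)] par[of R] by simp
    ultimately have "even (card (?O (Suc R)) + c * R)" using False
      by (cases R) auto
    then show ?thesis using par[of "Suc R"] by simp
  qed
qed simp

lemma unmatched_even_rank: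
  assumes "T \<in> unmatched r c t"
  shows "even (tab_rank r c T)"
proof -
  \<comment> \<open>The rank shift \<open>c * (r choose 2)\<close> is spread over the rows,
    \<open>c * (R - 1)\<close> for row \<open>R\<close>. Modulo 2, adding it is the same as
    subtracting it.\<close>
  have "even (\<Sum>R\<in>{1..r}. (\<Sum>j\<in>{1..c}. T (R, j)) + c * (R - 1))"
    using unmatched_row_parity[OF assms] by (intro dvd_sum) auto
  also have "(\<Sum>R\<in>{1..r}. (\<Sum>j\<in>{1..c}. T (R, j)) + c * (R - 1)) =
      (\<Sum>x\<in>{1..r} \<times> {1..c}. T x) + c * (r choose 2)"
    by (simp add: sum.distrib sum.cartesian_product sum_pred_eq_choose_2[symmetric] sum_distrib_left)
  finally show ?thesis
    unfolding tab_rank_def by (metis even_diff even_of_nat of_nat_add)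
qed

section \<open>A contracting homotopy that raises at the pivot\<close>

definition pivot :: "nat \<Rightarrow> nat \<Rightarrow> nat \<Rightarrow> tableau \<Rightarrow> nat \<times> nat" where
  "pivot r c t T = (SOME p. p \<in> active r c t T)"

text \<open>An active pivot failing (1) is of type (2): the tableau is the lower end of its cube
  edge in the pivot direction.\<close>

definition raisable :: "nat \<Rightarrow> nat \<Rightarrow> nat \<Rightarrow> tableau \<Rightarrow> bool" where
  "raisable r c t T \<longleftrightarrow> active r c t T \<noteq> {} \<and> \<not> cond1 r c T (fst (pivot r c t T)) (snd (pivot r c t T))"

definition raised :: "nat \<Rightarrow> nat \<Rightarrow> nat \<Rightarrow> tableau \<Rightarrow> tableau" where
  "raised r c t T = increment c T (fst (pivot r c t T)) (snd (pivot r c t T) - 1)"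

text \<open>Linear extension of the map that raises raisable tableaux and kills all others, given
  through its matrix.\<close>

definition homotopy :: "nat \<Rightarrow> nat \<Rightarrow> nat \<Rightarrow> chain \<Rightarrow> chain" where
  "homotopy r c t x =
     (\<lambda>U\<in>SSYT r c t. \<Sum>T\<in>SSYT r c t. x T * of_bool (raisable r c t T \<and> U = raised r c t T))"

lemma pivot_active: "active r c t T \<noteq> {} \<Longrightarrow> pivot r c t T \<in> active r c t T"
  unfolding pivot_def by (rule some_in_eq[THEN iffD2])

text \<open>The choice sees a tableau only through its active set, so all tableaux linked by
  boundary terms share one pivot direction.\<close>

lemma pivot_decrement:
  assumes "T \<in> SSYT r c t" "cond1 r c T R v"
  shows "pivot r c t (decrement c T R v) = pivot r c t T"
  by (simp add: pivot_def active_decrement[OF assms])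

lemma cond1_active: "cond1 r c T R v \<Longrightarrow> (R, v) \<in> active r c t T"
  by (simp add: active_def cond1_def)

lemma raisable_decrement:
  assumes T: "T \<in> SSYT r c t" and a: "cond1 r c T R v"
  shows "raisable r c t (decrement c T R v) \<longleftrightarrow> raisable r c t T \<or> pivot r c t T = (R, v)"
proof -
  have "active r c t T \<noteq> {}" using cond1_active[OF a] by blast
  then have "odd (snd (pivot r c t T))" using pivot_active by (fastforce simp: active_def)
  then show ?thesis
    using cond1_decrement(1)[OF T a] cond1_active[OF a, of t]
    by (auto simp: raisable_def pivot_decrement[OF T a] active_decrement[OF T a] prod_eq_iff)
qed

text \<open>Prepares the comparison of the two composites of boundary and homotopy: the raised
  tableau has the boundary terms of \<open>T\<close>, each raised, and one more at the pivot, which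
  leads back to \<open>T\<close>.\<close>

lemma raised_props:
  assumes T: "T \<in> SSYT r c t" and r: "raisable r c t T"
  defines "U \<equiv> raised r c t T" and "p \<equiv> pivot r c t T"
  shows "U \<in> SSYT r c t" and "cond1 r c U (fst p) (snd p)" and "decrement c U (fst p) (snd p) = T"
    and "{(R, v). cond1 r c U R v} = insert p {(R, v). cond1 r c T R v}"
    and "cond1 r c T R v \<Longrightarrow> raised r c t (decrement c T R v) = decrement c U R v"
proof -
  have "p \<in> active r c t T" using r pivot_active by (simp add: raisable_def p_def)
  then have v: "odd (snd p)" and c2: "cond2 r c t T (fst p) (snd p - 1)"
    using r by (auto simp: active_def raisable_def p_def split: prod.splits)
  have U: "U = increment c T (fst p) (snd p - 1)" by (simp add: U_def p_def raised_def)
  note * = increment_active[OF T v c2, folded U]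
  show "U \<in> SSYT r c t" "cond1 r c U (fst p) (snd p)" "decrement c U (fst p) (snd p) = T"
    by (rule *)+
  have "cond1 r c T Q w \<longleftrightarrow> cond1 r c U Q w \<and> (Q, w) \<noteq> p" for Q w
    using cond1_decrement(1)[OF *(1,2), of w Q] unfolding *(3)
    by (cases "odd w") (auto simp: cond1_def)
  then show "{(R, v). cond1 r c U R v} = insert p {(R, v). cond1 r c T R v}"
    using *(2) by auto
  show "raised r c t (decrement c T R v) = decrement c U R v" if "cond1 r c T R v"
    using increment_decrement_commute[OF T v c2 that]
    by (simp add: raised_def pivot_decrement[OF T that] U flip: p_def)
qed

lemma raised_decrement_pivot:
  assumes "T \<in> SSYT r c t" "cond1 r c T R v" "pivot r c t T = (R, v)"
  shows "raised r c t (decrement c T R v) = T"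
  using assms increment_decrement[OF assms(1,2)] by (simp add: raised_def pivot_decrement)

text \<open>The guard \<open>P\<close> lets \<open>a\<close> lie outside \<open>A\<close> when
  \<open>P\<close> is false; \<open>raised r c t T\<close> is known to be in
  \<open>SSYT r c t\<close> only for raisable \<open>T\<close>.\<close>

lemma sum_of_bool_mult_bit:
  fixes g :: "'a \<Rightarrow> bit"
  assumes "finite A" "P \<Longrightarrow> a \<in> A"
  shows "(\<Sum>x\<in>A. of_bool (P \<and> x = a) * g x) = (if P then g a else 0)"
proof (cases P)
  case True
  have "(\<Sum>x\<in>A. of_bool (P \<and> x = a) * g x) = (\<Sum>x\<in>A. if x = a then g x else 0)"
    using True by (intro sum.cong) auto
  then show ?thesis using True assms by simp
qed simp

text \<open>The matrix entry at \<open>(T, U)\<close> of the sum of both composites of boundary and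
  homotopy. Without active pairs both vanish; otherwise exactly one contribution, \<open>T\<close>
  itself, survives.\<close>

lemma homotopy_tableau:
  assumes T: "T \<in> SSYT r c t" and U: "U \<in> SSYT r c t"
  shows "(\<Sum>V\<in>SSYT r c t. of_bool (raisable r c t T \<and> V = raised r c t T) * tab_boundary r c t V U) +
    (\<Sum>V\<in>SSYT r c t. tab_boundary r c t T V * of_bool (raisable r c t V \<and> U = raised r c t V)) =
    of_bool (active r c t T \<noteq> {} \<and> T = U)" (is "?hd + ?dh = _")
proof -
  let ?A = "{(R, v). cond1 r c T R v}"
  let ?D = "\<lambda>T p. decrement c T (fst p) (snd p)"
  let ?p = "pivot r c t T"
  have dec: "?D T q \<in> SSYT r c t" if "q \<in> ?A" for q
    using that decrement_SSYT[OF T] by auto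
  \<comment> \<open>The names follow the order of application: \<open>?hd\<close> raises first and
    then takes the boundary.\<close>
  have hd: "?hd = (if raisable r c t T then tab_boundary r c t (raised r c t T) U else 0)"
    using raised_props(1)[OF T] by (intro sum_of_bool_mult_bit) auto
  have "?dh = (\<Sum>V\<in>SSYT r c t. \<Sum>q\<in>?A. of_bool (True \<and> V = ?D T q) *
      of_bool (raisable r c t V \<and> U = raised r c t V))"
    by (intro sum.cong) (simp_all add: tab_boundary_apply[of _ r c t T] sum_distrib_right)
  also have "\<dots> = (\<Sum>q\<in>?A. \<Sum>V\<in>SSYT r c t. of_bool (True \<and> V = ?D T q) *
      of_bool (raisable r c t V \<and> U = raised r c t V))"
    by (rule sum.swap)
  also have "\<dots> = (\<Sum>q\<in>?A. of_bool (raisable r c t (?D T q) \<and> U = raised r c t (?D T q)))"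
    using dec by (intro sum.cong[OF refl]) (subst sum_of_bool_mult_bit, simp_all)
  finally have dh: "?dh = (\<Sum>q\<in>?A. of_bool (raisable r c t (?D T q) \<and> U = raised r c t (?D T q)))" .
  consider "active r c t T = {}" | "raisable r c t T" | "?p \<in> ?A"
    by (auto simp: raisable_def case_prod_beta)
  then show ?thesis
  proof cases
    case 1
    then have "?A = {}" "\<not> raisable r c t T" using cond1_active[of r c T _ _ t] by (auto simp: raisable_def)
    then show ?thesis using 1 by (simp add: hd dh)
  next
    \<comment> \<open>Raising the terms of \<open>T\<close> gives the terms of the raised tableau
      away from the pivot, and these cancel in characteristic 2. The pivot term is
      \<open>T\<close>.\<close>
    case 2
    note p = raised_props[OF T 2]
    have "?p \<notin> ?A" using 2 by (auto simp: raisable_def)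
    then have "(\<Sum>q\<in>insert ?p ?A. of_bool (U = ?D (raised r c t T) q)) =
        of_bool (U = ?D (raised r c t T) ?p) + (\<Sum>q\<in>?A. of_bool (U = ?D (raised r c t T) q) :: bit)"
      by (intro sum.insert) simp_all
    then have "?hd = of_bool (U = T) + (\<Sum>q\<in>?A. of_bool (U = ?D (raised r c t T) q))"
      unfolding hd unfolding if_P[OF 2] tab_boundary_apply[OF U] p(3,4) .
    moreover have "?dh = (\<Sum>q\<in>?A. of_bool (U = ?D (raised r c t T) q))"
      unfolding dh using 2 by (intro sum.cong) (auto simp: raisable_decrement[OF T] p(5))
    moreover have "y + y = 0" for y :: bit by (cases y) auto
    ultimately show ?thesis using 2 by (auto simp: raisable_def add.assoc)
  next
    \<comment> \<open>\<open>T\<close> itself is sent to 0 by the homotopy, and among its boundary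
      terms only the one at the pivot is raisable; raising that term returns
      \<open>T\<close>.\<close>
    case 3
    then have c1: "cond1 r c T (fst ?p) (snd ?p)" by auto
    then have nr: "\<not> raisable r c t T" by (simp add: raisable_def)
    have "?dh = (\<Sum>q\<in>?A. of_bool (True \<and> q = ?p) * of_bool (U = T))"
      unfolding dh
    proof (rule sum.cong[OF refl])
      fix q assume "q \<in> ?A"
      then have q: "cond1 r c T (fst q) (snd q)" by auto
      show "of_bool (raisable r c t (?D T q) \<and> U = raised r c t (?D T q)) =
          (of_bool (True \<and> q = ?p) * of_bool (U = T) :: bit)"
      proof (cases "q = ?p")
        case True
        then show ?thesis
          using raisable_decrement[OF T q] raised_decrement_pivot[OF T q] by simp
      next
        case False
        then show ?thesis using raisable_decrement[OF T q] nr by auto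
      qed
    qed
    also have "\<dots> = of_bool (U = T)"
      using 3 by (subst sum_of_bool_mult_bit) auto
    finally show ?thesis using nr cond1_active[OF c1, of t] by (auto simp: hd)
  qed
qed

lemma homotopy_closed [simp]: "homotopy r c t x \<in> carrier (chain_space r c t)"
  by (simp add: homotopy_def chain_space_simps)

text \<open>Extends \<open>homotopy_tableau\<close> linearly: the identity is chain homotopic to the
  projection onto the span of the unmatched tableaux.\<close>

lemma homotopy_formula:
  assumes U: "U \<in> SSYT r c t"
  shows "boundary r c t (homotopy r c t x) U + homotopy r c t (boundary r c t x) U =
    (if U \<in> unmatched r c t then 0 else x U)"
proof -
  let ?S = "SSYT r c t"
  let ?h = "\<lambda>T U. of_bool (raisable r c t T \<and> U = raised r c t T) :: bit"
  have "boundary r c t (homotopy r c t x) U =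
    (\<Sum>V\<in>?S. \<Sum>T\<in>?S. x T * (?h T V * tab_boundary r c t V U))"
    unfolding boundary_apply[OF U]
    by (intro sum.cong) (simp_all add: homotopy_def sum_distrib_right mult.assoc)
  also have "\<dots> = (\<Sum>T\<in>?S. x T * (\<Sum>V\<in>?S. ?h T V * tab_boundary r c t V U))"
    by (subst sum.swap) (simp only: sum_distrib_left)
  finally have 1: "boundary r c t (homotopy r c t x) U = \<dots>" .
  have "homotopy r c t (boundary r c t x) U =
    (\<Sum>V\<in>?S. \<Sum>T\<in>?S. x T * (tab_boundary r c t T V * ?h V U))"
    unfolding homotopy_def restrict_apply'[OF U]
    by (intro sum.cong) (simp_all add: boundary_apply sum_distrib_right mult.assoc)
  also have "\<dots> = (\<Sum>T\<in>?S. x T * (\<Sum>V\<in>?S. tab_boundary r c t T V * ?h V U))"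
    by (subst sum.swap) (simp only: sum_distrib_left)
  finally have 2: "homotopy r c t (boundary r c t x) U = \<dots>" .
  have "boundary r c t (homotopy r c t x) U + homotopy r c t (boundary r c t x) U =
    (\<Sum>T\<in>?S. x T * of_bool (active r c t T \<noteq> {} \<and> T = U))"
    unfolding 1 2
    by (subst sum.distrib[symmetric], intro sum.cong refl)
      (simp only: distrib_left[symmetric] homotopy_tableau[OF _ U])
  also have "\<dots> = (\<Sum>T\<in>?S. of_bool (active r c t U \<noteq> {} \<and> T = U) * x T)"
    by (intro sum.cong) auto
  also have "\<dots> = (if active r c t U \<noteq> {} then x U else 0)"
    using U by (intro sum_of_bool_mult_bit) auto
  finally show ?thesis using U by (simp add: unmatched_iff_active)
qed

text \<open>A tableau with a boundary term has an active pair, and the term inherits it, so no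
  boundary term is unmatched.\<close>

lemma boundary_apply_unmatched:
  assumes U: "U \<in> unmatched r c t"
  shows "boundary r c t x U = 0"
proof -
  have S: "U \<in> SSYT r c t" using U by (simp add: unmatched_iff_active)
  have "U \<noteq> decrement c T R v" if "T \<in> SSYT r c t" "cond1 r c T R v" for T R v
    using active_decrement[OF that] cond1_active[OF that(2), of t] U by (auto simp: unmatched_iff_active)
  then have "tab_boundary r c t T U = 0" if "T \<in> SSYT r c t" for T
    using that unfolding tab_boundary_apply[OF S] by (intro sum.neutral) auto
  then show ?thesis unfolding boundary_apply[OF S] by simp
qed

text \<open>A raisable tableau is a boundary term of its raised one, so raising adds 1 to the
  rank.\<close>

lemma homotopy_graded_part:
  assumes x: "x \<in> graded_part r c t k"
  shows "homotopy r c t x \<in> graded_part r c t (k + 1)"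
proof -
  have "tab_rank r c U = k + 1" if U: "U \<in> SSYT r c t" and nz: "homotopy r c t x U \<noteq> 0" for U
  proof -
    obtain T where T: "T \<in> SSYT r c t"
      and "x T * of_bool (raisable r c t T \<and> U = raised r c t T) \<noteq> 0"
      using nz unfolding homotopy_def restrict_apply'[OF U]
      by (rule sum.not_neutral_contains_not_neutral)
    then have xT: "x T \<noteq> 0" and r: "raisable r c t T" and UT: "U = raised r c t T"
      by (auto split: if_splits)
    have "tab_rank r c T = tab_rank r c U - 1"
      using rank_decrement[OF raised_props(1,2)[OF T r]] raised_props(3)[OF T r] UT by simp
    then show ?thesis using x T xT by (auto simp: graded_part_def)
  qed
  then show ?thesis by (simp add: graded_part_def)
qed

section \<open>Boundaries and homology classes detected at unmatched tableaux\<close>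

lemma chain_eqI:
  assumes "x \<in> carrier (chain_space r c t)" "y \<in> carrier (chain_space r c t)"
    and "\<And>U. U \<in> SSYT r c t \<Longrightarrow> x U = y U"
  shows "x = y"
  using assms by (intro PiE_ext[where k = "SSYT r c t" and s = "\<lambda>_. UNIV"]) (simp_all add: chain_space_simps)

lemma homotopy_zero: "U \<in> SSYT r c t \<Longrightarrow> homotopy r c t \<zero>\<^bsub>chain_space r c t\<^esub> U = 0"
  by (simp add: homotopy_def chain_space_simps)

text \<open>On a cycle the second term of \<open>homotopy_formula\<close> vanishes, so the homotopy
  provides an explicit preimage; its rank is controlled, as needed for the graded statement.\<close>

lemma boundary_homotopy_cycle:
  assumes x: "x \<in> cycles r c t" and "\<And>U. U \<in> unmatched r c t \<Longrightarrow> x U = 0"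
  shows "boundary r c t (homotopy r c t x) = x"
proof (rule chain_eqI)
  fix U assume U: "U \<in> SSYT r c t"
  show "boundary r c t (homotopy r c t x) U = x U"
    using homotopy_formula[OF U, of x] x assms(2)[of U] homotopy_zero[OF U]
    by (auto simp: cycles_def split: if_splits)
qed (use x in \<open>simp_all add: cycles_def\<close>)

lemma boundaries_iff:
  "x \<in> boundaries r c t \<longleftrightarrow> x \<in> cycles r c t \<and> (\<forall>U\<in>unmatched r c t. x U = 0)"
proof
  assume "x \<in> boundaries r c t"
  then show "x \<in> cycles r c t \<and> (\<forall>U\<in>unmatched r c t. x U = 0)"
    by (auto simp: boundaries_def cycles_def boundary_boundary boundary_apply_unmatched)
next
  assume "x \<in> cycles r c t \<and> (\<forall>U\<in>unmatched r c t. x U = 0)"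
  then show "x \<in> boundaries r c t"
    using boundary_homotopy_cycle[of x r c t] unfolding boundaries_def
    by (metis homotopy_closed image_eqI)
qed

lemma submodule_boundaries: "submodule F2 (boundaries r c t) (chain_space r c t)"
proof -
  interpret vectorspace F2 "chain_space r c t" by (rule vectorspace_chain_space)
  interpret d: mod_hom F2 "chain_space r c t" "chain_space r c t" "boundary r c t"
    by unfold_locales (rule boundary_module_hom)
  show ?thesis using d.im_is_submodule by (simp add: d.im_def boundaries_def)
qed

lemma submodule_cycles: "submodule F2 (cycles r c t) (chain_space r c t)"
proof -
  interpret vectorspace F2 "chain_space r c t" by (rule vectorspace_chain_space)
  interpret d: mod_hom F2 "chain_space r c t" "chain_space r c t" "boundary r c t"
    by unfold_locales (rule boundary_module_hom)
  show ?thesis using d.ker_is_submodule by (simp add: d.ker_def cycles_def)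
qed

text \<open>Two classes agree iff the difference is a boundary, which \<open>boundaries_iff\<close>
  tests at unmatched tableaux. A class thus amounts to its coefficients there.\<close>

lemma homology_class_eq_iff:
  assumes x: "x \<in> cycles r c t" and y: "y \<in> cycles r c t"
  shows "homology_class r c t x = homology_class r c t y \<longleftrightarrow> (\<forall>U\<in>unmatched r c t. x U = y U)"
proof -
  let ?C = "chain_space r c t"
  interpret vectorspace F2 ?C by (rule vectorspace_chain_space)
  interpret S: abelian_subgroup "boundaries r c t" ?C
    by (rule submodule_abelian_subgroup[OF submodule_boundaries])
  interpret Z: submodule F2 "cycles r c t" ?C by (rule submodule_cycles)
  have xy: "x \<in> carrier ?C" "y \<in> carrier ?C" using x y by (auto simp: cycles_def)
  have self: "a + a = 0" for a :: bit by (cases a) auto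
  \<comment> \<open>In characteristic 2 every chain is its own negative, so sums serve as
    differences.\<close>
  have canc: "(x \<oplus>\<^bsub>?C\<^esub> y) \<oplus>\<^bsub>?C\<^esub> y = x"
    using xy by (intro chain_eqI[where r = r and c = c and t = t])
      (auto simp: chain_space_simps add.assoc self)
  have app: "(x \<oplus>\<^bsub>?C\<^esub> y) U = 0 \<longleftrightarrow> x U = y U" if "U \<in> unmatched r c t" for U
    using that by (cases "x U"; cases "y U") (auto simp: chain_space_simps unmatched_iff)
  have "homology_class r c t x = homology_class r c t y \<longleftrightarrow> x \<oplus>\<^bsub>?C\<^esub> y \<in> boundaries r c t"
  proof
    assume "homology_class r c t x = homology_class r c t y"
    then have "x \<in> boundaries r c t +>\<^bsub>?C\<^esub> y"
      using S.a_rcos_self[OF xy(1)] by (simp add: homology_class_def)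
    then obtain b where b: "b \<in> boundaries r c t" "x = b \<oplus>\<^bsub>?C\<^esub> y"
      by (auto simp: a_r_coset_def r_coset_def)
    have "x \<oplus>\<^bsub>?C\<^esub> y = b"
      using b xy S.a_subset by (intro chain_eqI[where r = r and c = c and t = t])
        (auto simp: chain_space_simps add.assoc self)
    then show "x \<oplus>\<^bsub>?C\<^esub> y \<in> boundaries r c t" using b by simp
  next
    assume "x \<oplus>\<^bsub>?C\<^esub> y \<in> boundaries r c t"
    then have "x \<in> boundaries r c t +>\<^bsub>?C\<^esub> y"
      using canc by (auto simp: a_r_coset_def r_coset_def intro: sym)
    then show "homology_class r c t x = homology_class r c t y"
      unfolding homology_class_def using M.a_repr_independence[OF _ xy(2) S.a_subgroup] by simp
  qed
  also have "\<dots> \<longleftrightarrow> (\<forall>U\<in>unmatched r c t. x U = y U)"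
    using Z.m_closed[OF x y] app by (simp add: boundaries_iff)
  finally show ?thesis .
qed

section \<open>Unmatched tableaux as a basis of the homology\<close>

lemma carrier_homology: "carrier (homology r c t) = homology_class r c t ` cycles r c t"
  by (auto simp: homology_def quotient_module_def A_RCOSETS_def RCOSETS_def homology_class_def
    a_r_coset_def r_coset_def)

lemma zero_homology: "\<zero>\<^bsub>homology r c t\<^esub> = homology_class r c t \<zero>\<^bsub>chain_space r c t\<^esub>"
proof -
  interpret vectorspace F2 "chain_space r c t" by (rule vectorspace_chain_space)
  interpret S: abelian_subgroup "boundaries r c t" "chain_space r c t"
    by (rule submodule_abelian_subgroup[OF submodule_boundaries])
  show ?thesis using S.a_subset by (simp add: homology_def quotient_module_def homology_class_def)
qed

lemma homology_class_add:
  assumes "x \<in> cycles r c t" "y \<in> cycles r c t"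
  shows "homology_class r c t x \<oplus>\<^bsub>homology r c t\<^esub> homology_class r c t y =
    homology_class r c t (x \<oplus>\<^bsub>chain_space r c t\<^esub> y)"
proof -
  interpret S: abelian_subgroup "boundaries r c t" "chain_space r c t"
    by (rule submodule_abelian_subgroup[OF submodule_boundaries])
  have "x \<in> carrier (chain_space r c t)" "y \<in> carrier (chain_space r c t)"
    using assms by (auto simp: cycles_def)
  then show ?thesis
    using S.a_rcos_sum[of x y]
    by (simp add: homology_def quotient_module_def homology_class_def set_add_def set_mult_def)
qed

text \<open>An unmatched tableau has no pair satisfying (1), so its boundary is an empty sum. Every
  coefficient vector on the unmatched tableaux therefore comes from a cycle.\<close>

lemma unmatched_chain_cycle:
  "(\<lambda>U\<in>SSYT r c t. if U \<in> unmatched r c t then f U else 0) \<in> cycles r c t" (is "?x \<in> _")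
proof -
  have "boundary r c t ?x = \<zero>\<^bsub>chain_space r c t\<^esub>"
  proof (rule chain_eqI)
    fix U assume U: "U \<in> SSYT r c t"
    have "tab_boundary r c t T U = 0" if "T \<in> unmatched r c t" for T
      using that unfolding tab_boundary_apply[OF U] by (intro sum.neutral) (auto simp: unmatched_iff)
    then show "boundary r c t ?x U = \<zero>\<^bsub>chain_space r c t\<^esub> U"
      using U unfolding boundary_apply[OF U] by (auto simp: chain_space_simps intro!: sum.neutral)
  qed (simp_all, simp add: chain_space_simps)
  then show ?thesis by (simp add: cycles_def chain_space_simps)
qed

lemma basis_elt_cycle:
  assumes "T \<in> unmatched r c t"
  shows "basis_elt r c t T \<in> cycles r c t"
proof -
  have "basis_elt r c t T =
    (\<lambda>U\<in>SSYT r c t. if U \<in> unmatched r c t then of_bool (U = T) else 0)"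
    unfolding basis_elt_def using assms by (intro restrict_ext) auto
  then show ?thesis by (simp only: unmatched_chain_cycle)
qed

text \<open>A basis given as an image cannot show repeated classes; injectivity excludes them and
  allows sums over classes to be reindexed by tableaux.\<close>

lemma inj_on_homology_class:
  "inj_on (\<lambda>T. homology_class r c t (basis_elt r c t T)) (unmatched r c t)"
proof (rule inj_onI)
  fix T U assume T: "T \<in> unmatched r c t" and U: "U \<in> unmatched r c t"
    and eq: "homology_class r c t (basis_elt r c t T) = homology_class r c t (basis_elt r c t U)"
  then have "basis_elt r c t T T = basis_elt r c t U T"
    by (simp add: homology_class_eq_iff basis_elt_cycle)
  then show "T = U" using T by (auto simp: basis_elt_def unmatched_iff split: if_splits)
qed

lemma finsum_homology_class:
  assumes "S \<subseteq> unmatched r c t"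
  shows "(\<Oplus>\<^bsub>homology r c t\<^esub>T\<in>S. f T \<odot>\<^bsub>homology r c t\<^esub> homology_class r c t (basis_elt r c t T)) =
    homology_class r c t (\<lambda>U\<in>SSYT r c t. if U \<in> unmatched r c t then if U \<in> S then f U else 0 else 0)"
proof -
  interpret H: vectorspace F2 "homology r c t" by (rule vectorspace_homology)
  have "unmatched r c t \<subseteq> SSYT r c t" by (auto simp: unmatched_iff)
  then have "finite S" using assms by (meson finite_SSYT finite_subset)
  then show ?thesis using assms
  proof (induction S rule: finite_induct)
    case empty
    have "\<zero>\<^bsub>chain_space r c t\<^esub> =
        (\<lambda>U\<in>SSYT r c t. if U \<in> unmatched r c t then if U \<in> {} then f U else 0 else 0)"
      unfolding chain_space_simps by (intro restrict_ext) auto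
    then show ?case by (simp only: H.M.finsum_empty zero_homology)
  next
    case (insert T S)
    let ?h = "\<lambda>T. homology_class r c t (basis_elt r c t T)"
    let ?x = "\<lambda>S. \<lambda>U\<in>SSYT r c t. if U \<in> unmatched r c t then if U \<in> S then f U else 0 else 0"
    have mem: "?h U \<in> carrier (homology r c t)" if "U \<in> unmatched r c t" for U
      using that by (simp add: carrier_homology basis_elt_cycle)
    have T: "T \<in> unmatched r c t" using insert.prems by simp
    have smult: "f T \<odot>\<^bsub>homology r c t\<^esub> ?h T =
        homology_class r c t (\<lambda>U\<in>SSYT r c t. if U \<in> unmatched r c t then if U = T then f T else 0 else 0)"
    \<comment> \<open>A scalar is 0 or 1, so the product is the zero class or the class
      itself.\<close>
    proof (cases "f T")
      case zero
      have "\<zero>\<^bsub>chain_space r c t\<^esub> =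
          (\<lambda>U\<in>SSYT r c t. if U \<in> unmatched r c t then if U = T then f T else 0 else 0)"
        unfolding chain_space_simps zero by (intro restrict_ext) auto
      then show ?thesis using H.lmult_0[OF mem[OF T]] zero by (simp add: zero_homology)
    next
      case one
      have "basis_elt r c t T = (\<lambda>U\<in>SSYT r c t. if U \<in> unmatched r c t then if U = T then 1 else 0 else 0)"
        unfolding basis_elt_def using T by (intro restrict_ext) auto
      then show ?thesis using H.smult_one[OF mem[OF T]] unfolding one by simp
    qed
    have "(\<Oplus>\<^bsub>homology r c t\<^esub>U\<in>insert T S. f U \<odot>\<^bsub>homology r c t\<^esub> ?h U) =
        f T \<odot>\<^bsub>homology r c t\<^esub> ?h T \<oplus>\<^bsub>homology r c t\<^esub> homology_class r c t (?x S)"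
    proof -
      have "(\<Oplus>\<^bsub>homology r c t\<^esub>U\<in>insert T S. f U \<odot>\<^bsub>homology r c t\<^esub> ?h U) =
          f T \<odot>\<^bsub>homology r c t\<^esub> ?h T \<oplus>\<^bsub>homology r c t\<^esub>
          (\<Oplus>\<^bsub>homology r c t\<^esub>U\<in>S. f U \<odot>\<^bsub>homology r c t\<^esub> ?h U)"
        using insert.hyps insert.prems mem by (intro H.M.finsum_insert) (auto intro!: H.smult_closed)
      also have "(\<Oplus>\<^bsub>homology r c t\<^esub>U\<in>S. f U \<odot>\<^bsub>homology r c t\<^esub> ?h U) = homology_class r c t (?x S)"
        using insert.prems by (intro insert.IH) simp
      finally show ?thesis .
    qed
    also have "\<dots> = homology_class r c t (?x (insert T S))"
      unfolding smult homology_class_add[OF unmatched_chain_cycle unmatched_chain_cycle]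
      unfolding chain_space_simps
      using insert.hyps by (intro arg_cong[of _ _ "homology_class r c t"] restrict_ext) auto
    finally show ?case .
  qed
qed

lemma basis_homology:
  "vectorspace.basis F2 (homology r c t)
    ((\<lambda>T. homology_class r c t (basis_elt r c t T)) ` unmatched r c t)"
proof -
  let ?H = "homology r c t" and ?U = "unmatched r c t"
  let ?h = "\<lambda>T. homology_class r c t (basis_elt r c t T)"
  interpret H: vectorspace F2 ?H by (rule vectorspace_homology)
  have US: "?U \<subseteq> SSYT r c t" by (auto simp: unmatched_iff)
  then have fin: "finite ?U" by (rule finite_subset) simp
  have sub: "?h ` ?U \<subseteq> carrier ?H" by (auto simp: carrier_homology basis_elt_cycle)
  have lincomb: "H.lincomb a (?h ` S) = homology_class r c t
      (\<lambda>T\<in>SSYT r c t. if T \<in> ?U then if T \<in> S then a (?h T) else 0 else 0)" if "S \<subseteq> ?U" for a S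
    unfolding H.lincomb_def
    using that sub inj_on_subset[OF inj_on_homology_class that]
    by (subst H.M.finsum_reindex) (auto simp: finsum_homology_class[OF that] intro!: H.smult_closed)
  have indpt: "H.lin_indpt (?h ` ?U)"
  proof
    assume "H.lin_dep (?h ` ?U)"
    then obtain A a X where A: "finite A" "A \<subseteq> ?h ` ?U" "H.lincomb a A = \<zero>\<^bsub>?H\<^esub>" "X \<in> A" "a X \<noteq> 0"
      unfolding H.lin_dep_def by auto
    obtain S where S: "S \<subseteq> ?U" "A = ?h ` S" using A(2) by (auto simp: subset_image_iff)
    obtain T where T: "T \<in> S" "X = ?h T" using A(4) S by auto
    let ?x = "\<lambda>T\<in>SSYT r c t. if T \<in> ?U then if T \<in> S then a (?h T) else 0 else 0"
    have 0: "\<zero>\<^bsub>chain_space r c t\<^esub> \<in> cycles r c t"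
      using submodule.zero_closed[OF submodule_cycles] .
    have "homology_class r c t ?x = homology_class r c t \<zero>\<^bsub>chain_space r c t\<^esub>"
      using A(3) lincomb[OF S(1), of a] unfolding S(2) zero_homology by (rule trans[OF sym, rotated])
    \<comment> \<open>Equal classes have equal coefficients at the unmatched \<open>T\<close>, where
      \<open>?x\<close> takes the value \<open>a X\<close>.\<close>
    then have "?x T = \<zero>\<^bsub>chain_space r c t\<^esub> T"
      unfolding homology_class_eq_iff[OF unmatched_chain_cycle 0] using S(1) T(1) by blast
    moreover have "T \<in> ?U" "T \<in> SSYT r c t" using S T US by auto
    ultimately have "a X = 0" using T by (simp add: chain_space_simps)
    then show False using A by simp
  qed
  have "carrier ?H \<subseteq> H.span (?h ` ?U)"
  proof
    fix X assume "X \<in> carrier ?H"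
    then obtain z where z: "z \<in> cycles r c t" "X = homology_class r c t z"
      by (auto simp: carrier_homology)
    \<comment> \<open>The class of \<open>T\<close> receives the coefficient of \<open>z\<close> at
      \<open>T\<close>; injectivity recovers \<open>T\<close> from its class.\<close>
    let ?a = "\<lambda>Y. z (the_inv_into ?U ?h Y)"
    have "X = H.lincomb ?a (?h ` ?U)"
      unfolding lincomb[OF subset_refl] z(2) homology_class_eq_iff[OF z(1) unmatched_chain_cycle]
      using US the_inv_into_f_f[OF inj_on_homology_class] by auto
    then show "X \<in> H.span (?h ` ?U)" unfolding H.span_def using fin by auto
  qed
  moreover have "H.span (?h ` ?U) \<subseteq> carrier ?H"
    using H.span_is_subset2[OF sub] .
  ultimately show ?thesis unfolding H.basis_def using indpt sub by auto
qed

section \<open>Vanishing of the homology in odd ranks\<close>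

lemma homology_at_odd:
  assumes "odd k"
  shows "carrier (homology_at r c t k) = {\<zero>\<^bsub>homology_at r c t k\<^esub>}"
proof -
  let ?C = "chain_space r c t"
  let ?B = "boundary r c t ` graded_part r c t (k + 1)"
  interpret vectorspace F2 ?C by (rule vectorspace_chain_space)
  \<comment> \<open>Unmatched tableaux have even rank, so a cycle of odd rank \<open>k\<close>
    vanishes on them, and the homotopy gives a preimage of rank \<open>k + 1\<close>.\<close>
  have "cycles r c t \<inter> graded_part r c t k \<subseteq> ?B"
  proof
    fix x assume x: "x \<in> cycles r c t \<inter> graded_part r c t k"
    have "x U = 0" if "U \<in> unmatched r c t" for U
      using x that unmatched_even_rank[OF that] assms by (auto simp: graded_part_def unmatched_iff)
    then have "boundary r c t (homotopy r c t x) = x" using x by (intro boundary_homotopy_cycle) auto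
    then show "x \<in> ?B" using homotopy_graded_part[of x r c t k] x by (metis IntD2 image_eqI)
  qed
  moreover have "?B \<subseteq> cycles r c t \<inter> graded_part r c t k"
    using boundary_graded_part by (auto simp: cycles_def boundary_boundary)
  ultimately have eq: "cycles r c t \<inter> graded_part r c t k = ?B" by simp
  have 0: "\<zero>\<^bsub>?C\<^esub> \<in> ?B"
    unfolding eq[symmetric] using submodule.zero_closed[OF submodule_cycles]
    by (auto simp: graded_part_def chain_space_simps)
  have add: "x \<oplus>\<^bsub>?C\<^esub> y \<in> ?B" if "x \<in> ?B" "y \<in> ?B" for x y
  proof -
    have xy: "x \<in> cycles r c t" "y \<in> cycles r c t" "x \<in> graded_part r c t k" "y \<in> graded_part r c t k"
      using that unfolding eq[symmetric] by auto
    have "tab_rank r c T = k" if T: "T \<in> SSYT r c t" and "(x \<oplus>\<^bsub>?C\<^esub> y) T \<noteq> 0" for T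
    proof -
      have "x T \<noteq> 0 \<or> y T \<noteq> 0" using that by (cases "x T") (auto simp: chain_space_simps)
      then show ?thesis using xy(3,4) T unfolding graded_part_def by blast
    qed
    moreover have "x \<oplus>\<^bsub>?C\<^esub> y \<in> carrier ?C" using xy(3,4) by (simp add: graded_part_def)
    ultimately have "x \<oplus>\<^bsub>?C\<^esub> y \<in> graded_part r c t k" unfolding graded_part_def by blast
    then show ?thesis unfolding eq[symmetric] using submodule.m_closed[OF submodule_cycles xy(1,2)] by simp
  qed
  have self: "a + (a + b) = b" for a b :: bit by (cases a; cases b) auto
  \<comment> \<open>\<open>?B\<close> is closed under addition and its elements are their own
    negatives, so translation by an element of \<open>?B\<close> fixes it. The only coset is then
    \<open>?B\<close>, the zero of the quotient.\<close>
  have "?B #>\<^bsub>add_monoid ?C\<^esub> y = ?B" if y: "y \<in> ?B" for y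
  proof
    show "?B #>\<^bsub>add_monoid ?C\<^esub> y \<subseteq> ?B" using add y by (auto simp: r_coset_def)
    show "?B \<subseteq> ?B #>\<^bsub>add_monoid ?C\<^esub> y"
    proof
      fix x assume x: "x \<in> ?B"
      have car: "x \<in> carrier ?C" "y \<in> carrier ?C" using x y by auto
      have "x = (x \<oplus>\<^bsub>?C\<^esub> y) \<oplus>\<^bsub>?C\<^esub> y"
        using car by (intro chain_eqI[where r = r and c = c and t = t])
          (auto simp: chain_space_simps add.commute self)
      then show "x \<in> ?B #>\<^bsub>add_monoid ?C\<^esub> y" using add[OF x y] unfolding r_coset_def by auto
    qed
  qed
  then have "(\<Union>y\<in>?B. {?B #>\<^bsub>add_monoid ?C\<^esub> y}) = {?B}" using 0 by auto
  then show ?thesis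
    by (simp add: homology_at_def quotient_module_def A_RCOSETS_def RCOSETS_def eq r_coset_def)
qed

theorem theorem5p8:
  fixes r c t :: nat
  assumes "r > 0" and "c > 0" and "t > 0"
  shows "(\<forall>k. odd k \<longrightarrow> carrier (homology_at r c t k) = {\<zero>\<^bsub>homology_at r c t k\<^esub>}) \<and>
    (\<forall>T\<in>unmatched r c t. basis_elt r c t T \<in> cycles r c t) \<and>
    inj_on (\<lambda>T. homology_class r c t (basis_elt r c t T)) (unmatched r c t) \<and>
    vectorspace.basis F2 (homology r c t)
      ((\<lambda>T. homology_class r c t (basis_elt r c t T)) ` unmatched r c t)"
  by (intro conjI allI impI ballI homology_at_odd basis_elt_cycle inj_on_homology_class basis_homology)

end
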